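(* Let $F\dashv G:\mathscr{L}\to\mathscr{X}$ be a symmetric monoidal adjunction between closed symmetric monoidal categories, with $\mathscr{L}$ finitely well-complete and with unit object $R$ of $\mathscr{L}$. Suppose that for each $X\in\mathscr{X}$ the cotensor $[X,R]$ in the $\mathscr{X}$-category $G_*\underline{\mathscr{L}}$ is reflexive as an object of $\mathscr{L}$. Then: (1) the morphism of $\mathscr{X}$-monads $j^{\widetilde{\mathbb{D}}}:\widetilde{\mathbb{D}}\to\mathbb{D}$ from the accessible distribution monad to the natural distribution monad is an isomorphism; (2) moreover, for each $X\in\mathscr{X}$ the embedding $i_{FX}:\widetilde{H}FX\to HFX=(FX)^{**}$ is an isomorphism in $\mathscr{L}$.
   Context: Setting. $\mathscr{X}=(\mathscr{X},\boxtimes,I)$ and $\mathscr{L}=(\mathscr{L},\otimes,R)$ are closed symmetric monoidal categories, and $F\dashv G:\mathscr{L}\to\mathscr{X}$ (unit $\eta$, counit $\varepsilon$) is an adjunction in the 2-category of symmetric monoidal categories, (lax) symmetric monoidal functors and monoidal transformations. $\underline{\mathscr{X}},\underline{\mathscr{L}}$ denote $\mathscr{X},\mathscr{L}$ regarded as categories enriched in themselves. $G_*$ is change of base along $G$: an $\mathscr{L}$-category $\mathscr{A}$ is sent to the $\mathscr{X}$-category $G_*\mathscr{A}$ with the same objects and $(G_*\mathscr{A})(A,B)=G(\mathscr{A}(A,B))$. The underlying ordinary category of $G_*\underline{\mathscr{L}}$ is identified with $\mathscr{L}$, and we write $\mathscr{L}(E,E')=G\underline{\mathscr{L}}(E,E')$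 for its hom-objects. $G$ carries the structure of an $\mathscr{X}$-functor $G_*\underline{\mathscr{L}}\to\underline{\mathscr{X}}$, with structure morphisms $G\underline{\mathscr{L}}(E,E')\to\underline{\mathscr{X}}(GE,GE')$ the transposes of $GE\boxtimes G\underline{\mathscr{L}}(E,E')\to G(E\otimes\underline{\mathscr{L}}(E,E'))\to GE'$, and $F\dashv G$ thereby underlies an $\mathscr{X}$-adjunction $F\dashv G:G_*\underline{\mathscr{L}}\to\underline{\mathscr{X}}$ with the same unit and counit. The $\mathscr{X}$-category $G_*\underline{\mathscr{L}}$ is cotensored, with cotensors $[X,E]=\underline{\mathscr{L}}(FX,E)$. For an $\mathscr{X}$-monad $\mathbb{M}=(M,e,m)$ on $G_*\underline{\mathscr{L}}$, $[F,G](\mathbb{M})$ denotes the $\mathscr{X}$-monad on $\underline{\mathscr{X}}$ with endofunctor $GMF$, unit $(GeF)\cdot\eta$ and multiplication $(GmF)\cdot(GM\varepsilon MF)$. Duals. $E^*:=\underline{\mathscr{L}}(E,R)$. $\mathbb{H}=(H,\mathfrak{d},\mathfrak{k})$ is the double-dualization $\mathscr{L}$-monad on $\underline{\mathscr{L}}$, induced by the $\mathscr{L}$-adjunction $\underline{\mathscr{L}}(-,R)\dashv\underline{\mathscr{L}}(-,R):\underline{\mathscr{L}}^{\mathrm{op}}\to\underline{\mathscr{L}}$; so $HE=E^{**}$. $E$ is reflexive if $\mathfrak{d}_E:E\to E^{**}$ is an isomorphism. Natural distribution monad. $\mathbb{D}$ is the $\mathscr{X}$-monad on $\underline{\mathscr{X}}$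 induced by the $\mathscr{X}$-adjunction $[-,R]\dashv\mathscr{L}(-,R):(G_*\underline{\mathscr{L}})^{\mathrm{op}}\to\underline{\mathscr{X}}$, so $DX=\mathscr{L}([X,R],R)$. With $[X,R]=\underline{\mathscr{L}}(FX,R)$ one has $\mathbb{D}=[F,G](G_*\mathbb{H})$, so $DX=GHFX$. Finitely well-complete: having finite limits and intersections (fibre products) of arbitrary class-indexed families of strong monomorphisms with common codomain. Functional completeness. $E\in\mathscr{L}$ is functionally complete if for every $h:E_1\to E_2$ in $\mathscr{L}$ such that $h^{**}$ is an isomorphism, $\underline{\mathscr{L}}(h,E):\underline{\mathscr{L}}(E_2,E)\to\underline{\mathscr{L}}(E_1,E)$ is an isomorphism. When $\mathscr{L}$ is finitely well-complete, the functionally complete objects form an $\mathscr{L}$-reflective subcategory of $\underline{\mathscr{L}}$; $\widetilde{\mathbb{H}}=(\widetilde{H},\widetilde{\mathfrak{d}},\widetilde{\mathfrak{k}})$ denotes the associated idempotent $\mathscr{L}$-monad on $\underline{\mathscr{L}}$, and $i:\widetilde{\mathbb{H}}\to\mathbb{H}$ the unique morphism of $\mathscr{L}$-monads; $i_E$ is the unique morphism with $i_E\cdot\widetilde{\mathfrak{d}}_E=\mathfrak{d}_E$, and it is a strong monomorphism (embedding). Accessible distribution monad. $\widetilde{\mathbb{D}}:=[F,G](G_*\widetilde{\mathbb{H}})$, so $\widetilde{D}X=G\widetilde{H}FX$, and $j^{\widetilde{\mathbb{D}}}:=GiF:\widetilde{\mathbb{D}}\to\mathbb{D}$, a morphism of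 $\mathscr{X}$-monads. *)

theory Defs
  imports Main
begin

section \<open>Ordinary categories\<close>

text \<open>
  A category has a set of objects and a set of arrows inside two ambient types; composition is
  written in applicative order.  Operations are only meaningful on their carriers.
\<close>

record ('o, 'm) cat =
  Ob :: "'o set"
  Ar :: "'m set"
  Dom :: "'m \<Rightarrow> 'o"
  Cod :: "'m \<Rightarrow> 'o"
  Id :: "'o \<Rightarrow> 'm"
  Comp :: "'m \<Rightarrow> 'm \<Rightarrow> 'm" (infixr "\<cdot>\<index>" 75)

definition hom :: "('o, 'm, 'z) cat_scheme \<Rightarrow> 'o \<Rightarrow> 'o \<Rightarrow> 'm set" where
  "hom C A B = {f \<in> Ar C. Dom C f = A \<and> Cod C f = B}"

locale category =
  fixes C :: "('o, 'm, 'z) cat_scheme" (structure)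
  assumes Dom_Ob: "f \<in> Ar C \<Longrightarrow> Dom C f \<in> Ob C"
    and Cod_Ob: "f \<in> Ar C \<Longrightarrow> Cod C f \<in> Ob C"
    and Id_hom: "A \<in> Ob C \<Longrightarrow> Id C A \<in> hom C A A"
    and Comp_hom: "f \<in> hom C A B \<Longrightarrow> g \<in> hom C B D \<Longrightarrow> g \<cdot> f \<in> hom C A D"
    and Comp_Id: "f \<in> hom C A B \<Longrightarrow> f \<cdot> Id C A = f"
    and Id_Comp: "f \<in> hom C A B \<Longrightarrow> Id C B \<cdot> f = f"
    and Comp_assoc: "f \<in> hom C A B \<Longrightarrow> g \<in> hom C B D \<Longrightarrow> h \<in> hom C D E \<Longrightarrow>
      (h \<cdot> g) \<cdot> f = h \<cdot> (g \<cdot> f)"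

definition are_inverse :: "('o, 'm, 'z) cat_scheme \<Rightarrow> 'm \<Rightarrow> 'm \<Rightarrow> bool" where
  "are_inverse C f g \<longleftrightarrow> f \<in> Ar C \<and> g \<in> hom C (Cod C f) (Dom C f) \<and>
     Comp C g f = Id C (Dom C f) \<and> Comp C f g = Id C (Cod C f)"

definition is_iso :: "('o, 'm, 'z) cat_scheme \<Rightarrow> 'm \<Rightarrow> bool" where
  "is_iso C f \<longleftrightarrow> (\<exists>g. are_inverse C f g)"

definition inverse_of :: "('o, 'm, 'z) cat_scheme \<Rightarrow> 'm \<Rightarrow> 'm" where
  "inverse_of C f = (THE g. are_inverse C f g)"

definition is_mono :: "('o, 'm, 'z) cat_scheme \<Rightarrow> 'm \<Rightarrow> bool" where
  "is_mono C f \<longleftrightarrow> f \<in> Ar C \<and>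
     (\<forall>A. \<forall>u \<in> hom C A (Dom C f). \<forall>v \<in> hom C A (Dom C f). Comp C f u = Comp C f v \<longrightarrow> u = v)"

definition is_epi :: "('o, 'm, 'z) cat_scheme \<Rightarrow> 'm \<Rightarrow> bool" where
  "is_epi C f \<longleftrightarrow> f \<in> Ar C \<and>
     (\<forall>A. \<forall>u \<in> hom C (Cod C f) A. \<forall>v \<in> hom C (Cod C f) A. Comp C u f = Comp C v f \<longrightarrow> u = v)"

definition orthogonal :: "('o, 'm, 'z) cat_scheme \<Rightarrow> 'm \<Rightarrow> 'm \<Rightarrow> bool" where
  "orthogonal C e m \<longleftrightarrow>
     (\<forall>u \<in> hom C (Dom C e) (Dom C m). \<forall>v \<in> hom C (Cod C e) (Cod C m).
        Comp C v e = Comp C m u \<longrightarrow>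
        (\<exists>!w. w \<in> hom C (Cod C e) (Dom C m) \<and> Comp C w e = u \<and> Comp C m w = v))"

definition strong_mono :: "('o, 'm, 'z) cat_scheme \<Rightarrow> 'm \<Rightarrow> bool" where
  "strong_mono C m \<longleftrightarrow> is_mono C m \<and> (\<forall>e. is_epi C e \<longrightarrow> orthogonal C e m)"

subsection \<open>Functors, limits, finite well-completeness\<close>

record ('o, 'm, 'p, 'n) func =
  fob :: "'o \<Rightarrow> 'p"
  far :: "'m \<Rightarrow> 'n"

locale cat_functor = dom: category C + cod: category D
  for C :: "('o, 'm, 'y) cat_scheme" and D :: "('p, 'n, 'z) cat_scheme"
    and T :: "('o, 'm, 'p, 'n, 'w) func_scheme" +
  assumes fob_Ob: "A \<in> Ob C \<Longrightarrow> fob T A \<in> Ob D"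
    and far_hom: "f \<in> hom C A B \<Longrightarrow> far T f \<in> hom D (fob T A) (fob T B)"
    and far_Id: "A \<in> Ob C \<Longrightarrow> far T (Id C A) = Id D (fob T A)"
    and far_Comp: "f \<in> hom C A B \<Longrightarrow> g \<in> hom C B E \<Longrightarrow>
      far T (g \<cdot>\<^bsub>C\<^esub> f) = far T g \<cdot>\<^bsub>D\<^esub> far T f"

definition is_cone ::
  "('i, 'j, 'y) cat_scheme \<Rightarrow> ('o, 'm, 'z) cat_scheme \<Rightarrow> ('i, 'j, 'o, 'm, 'w) func_scheme
    \<Rightarrow> 'o \<Rightarrow> ('i \<Rightarrow> 'm) \<Rightarrow> bool" where
  "is_cone J C T A p \<longleftrightarrow> A \<in> Ob C \<and>
     (\<forall>i \<in> Ob J. p i \<in> hom C A (fob T i)) \<and>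
     (\<forall>a \<in> Ar J. Comp C (far T a) (p (Dom J a)) = p (Cod J a))"

definition is_limit ::
  "('i, 'j, 'y) cat_scheme \<Rightarrow> ('o, 'm, 'z) cat_scheme \<Rightarrow> ('i, 'j, 'o, 'm, 'w) func_scheme
    \<Rightarrow> 'o \<Rightarrow> ('i \<Rightarrow> 'm) \<Rightarrow> bool" where
  "is_limit J C T A p \<longleftrightarrow> is_cone J C T A p \<and>
     (\<forall>B q. is_cone J C T B q \<longrightarrow>
        (\<exists>!u. u \<in> hom C B A \<and> (\<forall>i \<in> Ob J. Comp C (p i) u = q i)))"

text \<open>Every finite category is isomorphic to one whose objects and arrows are natural numbers.\<close>

definition has_finite_limits :: "('o, 'm, 'z) cat_scheme \<Rightarrow> bool" where
  "has_finite_limits C \<longleftrightarrow>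
     (\<forall>(J :: (nat, nat) cat) (T :: (nat, nat, 'o, 'm) func).
        finite (Ob J) \<and> finite (Ar J) \<and> cat_functor J C T \<longrightarrow> (\<exists>A p. is_limit J C T A p))"

text \<open>
  Fibre product of the family of all members of \<open>S\<close>, a set of arrows into \<open>B\<close>.
  Repetitions in a family of monomorphisms do not affect its fibre product, so sets of arrows
  (of arbitrary size) account for all class-indexed families of monomorphisms.
\<close>

definition is_fibre_product ::
  "('o, 'm, 'z) cat_scheme \<Rightarrow> 'o \<Rightarrow> 'm set \<Rightarrow> 'm \<Rightarrow> ('m \<Rightarrow> 'm) \<Rightarrow> bool" where
  "is_fibre_product C B S k p \<longleftrightarrow> k \<in> Ar C \<and> Cod C k = B \<and>
     (\<forall>m \<in> S. p m \<in> hom C (Dom C k) (Dom C m) \<and> Comp C m (p m) = k) \<and>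
     (\<forall>A. \<forall>t \<in> hom C A B. \<forall>q.
        (\<forall>m \<in> S. q m \<in> hom C A (Dom C m) \<and> Comp C m (q m) = t) \<longrightarrow>
        (\<exists>!u. u \<in> hom C A (Dom C k) \<and> Comp C k u = t \<and> (\<forall>m \<in> S. Comp C (p m) u = q m)))"

definition finitely_well_complete :: "('o, 'm, 'z) cat_scheme \<Rightarrow> bool" where
  "finitely_well_complete C \<longleftrightarrow> has_finite_limits C \<and>
     (\<forall>B \<in> Ob C. \<forall>S. (\<forall>m \<in> S. strong_mono C m \<and> Cod C m = B) \<longrightarrow>
        (\<exists>k p. is_fibre_product C B S k p))"

section \<open>Closed symmetric monoidal categories\<close>

text \<open>
  \<open>\<otimes>\<close> acts on objects and \<open>\<odot>\<close> on arrows.  The internal hom is right adjoint to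
  \<open>A \<otimes> -\<close>, so evaluation is \<open>A \<otimes> [A,B] \<rightarrow> B\<close>.
\<close>

record ('o, 'm) smcc = "('o, 'm) cat" +
  tens :: "'o \<Rightarrow> 'o \<Rightarrow> 'o" (infixr "\<otimes>\<index>" 80)
  tensa :: "'m \<Rightarrow> 'm \<Rightarrow> 'm" (infixr "\<odot>\<index>" 80)
  Unit :: "'o"
  assc :: "'o \<Rightarrow> 'o \<Rightarrow> 'o \<Rightarrow> 'm"
  lunit :: "'o \<Rightarrow> 'm"
  runit :: "'o \<Rightarrow> 'm"
  symm :: "'o \<Rightarrow> 'o \<Rightarrow> 'm"
  ihom :: "'o \<Rightarrow> 'o \<Rightarrow> 'o"
  ev :: "'o \<Rightarrow> 'o \<Rightarrow> 'm"

locale closed_symmetric_monoidal_category = category V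
  for V :: "('o, 'm, 'z) smcc_scheme" (structure) +
  assumes Unit_Ob: "Unit V \<in> Ob V"
    and tens_Ob: "A \<in> Ob V \<Longrightarrow> B \<in> Ob V \<Longrightarrow> A \<otimes> B \<in> Ob V"
    and tensa_hom: "f \<in> hom V A A' \<Longrightarrow> g \<in> hom V B B' \<Longrightarrow> f \<odot> g \<in> hom V (A \<otimes> B) (A' \<otimes> B')"
    and tensa_Id: "A \<in> Ob V \<Longrightarrow> B \<in> Ob V \<Longrightarrow> Id V A \<odot> Id V B = Id V (A \<otimes> B)"
    and tensa_Comp: "f \<in> hom V A A' \<Longrightarrow> f' \<in> hom V A' A'' \<Longrightarrow>
      g \<in> hom V B B' \<Longrightarrow> g' \<in> hom V B' B'' \<Longrightarrow>
      (f' \<cdot> f) \<odot> (g' \<cdot> g) = (f' \<odot> g') \<cdot> (f \<odot> g)"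
    and assc_hom: "A \<in> Ob V \<Longrightarrow> B \<in> Ob V \<Longrightarrow> D \<in> Ob V \<Longrightarrow>
      assc V A B D \<in> hom V ((A \<otimes> B) \<otimes> D) (A \<otimes> (B \<otimes> D))"
    and assc_iso: "A \<in> Ob V \<Longrightarrow> B \<in> Ob V \<Longrightarrow> D \<in> Ob V \<Longrightarrow> is_iso V (assc V A B D)"
    and assc_natural: "f \<in> hom V A A' \<Longrightarrow> g \<in> hom V B B' \<Longrightarrow> h \<in> hom V D D' \<Longrightarrow>
      assc V A' B' D' \<cdot> ((f \<odot> g) \<odot> h) = (f \<odot> (g \<odot> h)) \<cdot> assc V A B D"
    and lunit_hom: "A \<in> Ob V \<Longrightarrow> lunit V A \<in> hom V (Unit V \<otimes> A) A"
    and lunit_iso: "A \<in> Ob V \<Longrightarrow> is_iso V (lunit V A)"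
    and lunit_natural: "f \<in> hom V A A' \<Longrightarrow>
      lunit V A' \<cdot> (Id V (Unit V) \<odot> f) = f \<cdot> lunit V A"
    and runit_hom: "A \<in> Ob V \<Longrightarrow> runit V A \<in> hom V (A \<otimes> Unit V) A"
    and runit_iso: "A \<in> Ob V \<Longrightarrow> is_iso V (runit V A)"
    and runit_natural: "f \<in> hom V A A' \<Longrightarrow>
      runit V A' \<cdot> (f \<odot> Id V (Unit V)) = f \<cdot> runit V A"
    and symm_hom: "A \<in> Ob V \<Longrightarrow> B \<in> Ob V \<Longrightarrow> symm V A B \<in> hom V (A \<otimes> B) (B \<otimes> A)"
    and symm_natural: "f \<in> hom V A A' \<Longrightarrow> g \<in> hom V B B' \<Longrightarrow>
      symm V A' B' \<cdot> (f \<odot> g) = (g \<odot> f) \<cdot> symm V A B"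
    and pentagon: "A \<in> Ob V \<Longrightarrow> B \<in> Ob V \<Longrightarrow> D \<in> Ob V \<Longrightarrow> E \<in> Ob V \<Longrightarrow>
      (Id V A \<odot> assc V B D E) \<cdot> assc V A (B \<otimes> D) E \<cdot> (assc V A B D \<odot> Id V E)
      = assc V A B (D \<otimes> E) \<cdot> assc V (A \<otimes> B) D E"
    and triangle: "A \<in> Ob V \<Longrightarrow> B \<in> Ob V \<Longrightarrow>
      (Id V A \<odot> lunit V B) \<cdot> assc V A (Unit V) B = runit V A \<odot> Id V B"
    and symm_symm: "A \<in> Ob V \<Longrightarrow> B \<in> Ob V \<Longrightarrow> symm V B A \<cdot> symm V A B = Id V (A \<otimes> B)"
    and hexagon: "A \<in> Ob V \<Longrightarrow> B \<in> Ob V \<Longrightarrow> D \<in> Ob V \<Longrightarrow>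
      assc V B D A \<cdot> symm V A (B \<otimes> D) \<cdot> assc V A B D
      = (Id V B \<odot> symm V A D) \<cdot> assc V B A D \<cdot> (symm V A B \<odot> Id V D)"
    and ihom_Ob: "A \<in> Ob V \<Longrightarrow> B \<in> Ob V \<Longrightarrow> ihom V A B \<in> Ob V"
    and ev_hom: "A \<in> Ob V \<Longrightarrow> B \<in> Ob V \<Longrightarrow> ev V A B \<in> hom V (A \<otimes> ihom V A B) B"
    and ev_universal: "A \<in> Ob V \<Longrightarrow> B \<in> Ob V \<Longrightarrow> D \<in> Ob V \<Longrightarrow> f \<in> hom V (A \<otimes> D) B \<Longrightarrow>
      \<exists>!g. g \<in> hom V D (ihom V A B) \<and> ev V A B \<cdot> (Id V A \<odot> g) = f"

text \<open>Transpose \<open>D \<rightarrow> [A,B]\<close> of an arrow \<open>f : A \<otimes> D \<rightarrow> B\<close>.\<close>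

definition curry :: "('o, 'm, 'z) smcc_scheme \<Rightarrow> 'o \<Rightarrow> 'o \<Rightarrow> 'o \<Rightarrow> 'm \<Rightarrow> 'm" where
  "curry V A D B f =
     (THE g. g \<in> hom V D (ihom V A B) \<and> Comp V (ev V A B) (tensa V (Id V A) g) = f)"

text \<open>\<open>[h,f] : [A,B] \<rightarrow> [A',B']\<close> for \<open>h : A' \<rightarrow> A\<close> and \<open>f : B \<rightarrow> B'\<close>.\<close>

definition hmap :: "('o, 'm, 'z) smcc_scheme \<Rightarrow> 'm \<Rightarrow> 'm \<Rightarrow> 'm" where
  "hmap V h f = (let A' = Dom V h; A = Cod V h; B = Dom V f; B' = Cod V f in
     curry V A' (ihom V A B) B'
       (Comp V f (Comp V (ev V A B) (tensa V h (Id V (ihom V A B))))))"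

text \<open>The composition \<open>[B,D] \<otimes> [A,B] \<rightarrow> [A,D]\<close> of the self-enriched category.\<close>

definition icomp :: "('o, 'm, 'z) smcc_scheme \<Rightarrow> 'o \<Rightarrow> 'o \<Rightarrow> 'o \<Rightarrow> 'm" where
  "icomp V A B D =
     curry V A (tens V (ihom V B D) (ihom V A B)) D
       (Comp V (ev V B D)
         (Comp V (tensa V (ev V A B) (Id V (ihom V B D)))
           (Comp V (inverse_of V (assc V A (ihom V A B) (ihom V B D)))
             (tensa V (Id V A) (symm V (ihom V B D) (ihom V A B))))))"

text \<open>
  The structure \<open>[A,B] \<rightarrow> [[B,D],[A,D]]\<close> of the contravariant enriched functor \<open>[-,D]\<close>.
\<close>

definition ihom_contra :: "('o, 'm, 'z) smcc_scheme \<Rightarrow> 'o \<Rightarrow> 'o \<Rightarrow> 'o \<Rightarrow> 'm" where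
  "ihom_contra V D A B =
     curry V (ihom V B D) (ihom V A B) (ihom V A D) (icomp V A B D)"

section \<open>Symmetric monoidal adjunctions\<close>

text \<open>
  \<open>mult T A B : T A \<otimes> T B \<rightarrow> T (A \<otimes> B)\<close> and \<open>munit T : I \<rightarrow> T I\<close>; neither is assumed to be
  invertible.
\<close>

record ('o, 'm, 'p, 'n) mfunc = "('o, 'm, 'p, 'n) func" +
  mult :: "'o \<Rightarrow> 'o \<Rightarrow> 'n"
  munit :: "'n"

locale symmetric_monoidal_functor =
  cat_functor V W T +
  dom: closed_symmetric_monoidal_category V +
  cod: closed_symmetric_monoidal_category W
  for V :: "('o, 'm, 'y) smcc_scheme" and W :: "('p, 'n, 'z) smcc_scheme"
    and T :: "('o, 'm, 'p, 'n, 'w) mfunc_scheme" +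
  assumes mult_hom: "A \<in> Ob V \<Longrightarrow> B \<in> Ob V \<Longrightarrow>
      mult T A B \<in> hom W (fob T A \<otimes>\<^bsub>W\<^esub> fob T B) (fob T (A \<otimes>\<^bsub>V\<^esub> B))"
    and mult_natural: "f \<in> hom V A A' \<Longrightarrow> g \<in> hom V B B' \<Longrightarrow>
      mult T A' B' \<cdot>\<^bsub>W\<^esub> (far T f \<odot>\<^bsub>W\<^esub> far T g) = far T (f \<odot>\<^bsub>V\<^esub> g) \<cdot>\<^bsub>W\<^esub> mult T A B"
    and munit_hom: "munit T \<in> hom W (Unit W) (fob T (Unit V))"
    and mult_assc: "A \<in> Ob V \<Longrightarrow> B \<in> Ob V \<Longrightarrow> D \<in> Ob V \<Longrightarrow>
      far T (assc V A B D) \<cdot>\<^bsub>W\<^esub> mult T (A \<otimes>\<^bsub>V\<^esub> B) D \<cdot>\<^bsub>W\<^esub> (mult T A B \<odot>\<^bsub>W\<^esub> Id W (fob T D))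
      = mult T A (B \<otimes>\<^bsub>V\<^esub> D) \<cdot>\<^bsub>W\<^esub> (Id W (fob T A) \<odot>\<^bsub>W\<^esub> mult T B D)
          \<cdot>\<^bsub>W\<^esub> assc W (fob T A) (fob T B) (fob T D)"
    and mult_lunit: "A \<in> Ob V \<Longrightarrow>
      far T (lunit V A) \<cdot>\<^bsub>W\<^esub> mult T (Unit V) A \<cdot>\<^bsub>W\<^esub> (munit T \<odot>\<^bsub>W\<^esub> Id W (fob T A))
      = lunit W (fob T A)"
    and mult_runit: "A \<in> Ob V \<Longrightarrow>
      far T (runit V A) \<cdot>\<^bsub>W\<^esub> mult T A (Unit V) \<cdot>\<^bsub>W\<^esub> (Id W (fob T A) \<odot>\<^bsub>W\<^esub> munit T)
      = runit W (fob T A)"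
    and mult_symm: "A \<in> Ob V \<Longrightarrow> B \<in> Ob V \<Longrightarrow>
      far T (symm V A B) \<cdot>\<^bsub>W\<^esub> mult T A B = mult T B A \<cdot>\<^bsub>W\<^esub> symm W (fob T A) (fob T B)"

locale symmetric_monoidal_adjunction =
  F: symmetric_monoidal_functor X L F +
  G: symmetric_monoidal_functor L X G
  for X :: "('x, 'a, 'y) smcc_scheme" and L :: "('l, 'b, 'z) smcc_scheme"
    and F :: "('x, 'a, 'l, 'b, 'v) mfunc_scheme" and G :: "('l, 'b, 'x, 'a, 'w) mfunc_scheme" +
  fixes \<eta> :: "'x \<Rightarrow> 'a" and \<epsilon> :: "'l \<Rightarrow> 'b"
  assumes eta_hom: "A \<in> Ob X \<Longrightarrow> \<eta> A \<in> hom X A (fob G (fob F A))"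
    and eta_natural: "f \<in> hom X A B \<Longrightarrow> \<eta> B \<cdot>\<^bsub>X\<^esub> f = far G (far F f) \<cdot>\<^bsub>X\<^esub> \<eta> A"
    and eps_hom: "E \<in> Ob L \<Longrightarrow> \<epsilon> E \<in> hom L (fob F (fob G E)) E"
    and eps_natural: "g \<in> hom L E E' \<Longrightarrow> \<epsilon> E' \<cdot>\<^bsub>L\<^esub> far F (far G g) = g \<cdot>\<^bsub>L\<^esub> \<epsilon> E"
    and triangle_F: "A \<in> Ob X \<Longrightarrow> \<epsilon> (fob F A) \<cdot>\<^bsub>L\<^esub> far F (\<eta> A) = Id L (fob F A)"
    and triangle_G: "E \<in> Ob L \<Longrightarrow> far G (\<epsilon> E) \<cdot>\<^bsub>X\<^esub> \<eta> (fob G E) = Id X (fob G E)"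
    and eta_mult: "A \<in> Ob X \<Longrightarrow> B \<in> Ob X \<Longrightarrow>
      far G (mult F A B) \<cdot>\<^bsub>X\<^esub> mult G (fob F A) (fob F B) \<cdot>\<^bsub>X\<^esub> (\<eta> A \<odot>\<^bsub>X\<^esub> \<eta> B) = \<eta> (A \<otimes>\<^bsub>X\<^esub> B)"
    and eta_munit: "far G (munit F) \<cdot>\<^bsub>X\<^esub> munit G = \<eta> (Unit X)"
    and eps_mult: "E \<in> Ob L \<Longrightarrow> E' \<in> Ob L \<Longrightarrow>
      \<epsilon> (E \<otimes>\<^bsub>L\<^esub> E') \<cdot>\<^bsub>L\<^esub> far F (mult G E E') \<cdot>\<^bsub>L\<^esub> mult F (fob G E) (fob G E') = \<epsilon> E \<odot>\<^bsub>L\<^esub> \<epsilon> E'"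
    and eps_munit: "\<epsilon> (Unit L) \<cdot>\<^bsub>L\<^esub> far F (munit G) \<cdot>\<^bsub>L\<^esub> munit F = Id L (Unit L)"

section \<open>Enriched monads\<close>

text \<open>
  Data of an enriched monad \<open>M\<close> on an enriched category whose objects have type \<open>'o\<close>, whose
  underlying arrows have type \<open>'m\<close>, and whose base of enrichment has arrows of type \<open>'h\<close>:
  object map, underlying action on arrows, enriched structure \<open>(A,B) \<rightarrow> (M A, M B)\<close> on
  hom-objects, unit and multiplication.  For a self-enriched \<open>V\<close> both \<open>'m\<close> and \<open>'h\<close> are the arrows of
  \<open>V\<close>; for the change of base of \<open>L\<close> along \<open>G : L \<rightarrow> X\<close>, whose underlying category is identified with
  \<open>L\<close>, \<open>'m\<close> is the type of arrows of \<open>L\<close> and \<open>'h\<close> that of \<open>X\<close>.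
\<close>

record ('o, 'm, 'h) emonad =
  Mob :: "'o \<Rightarrow> 'o"
  Mar :: "'m \<Rightarrow> 'm"
  Mhom :: "'o \<Rightarrow> 'o \<Rightarrow> 'h"
  Munit :: "'o \<Rightarrow> 'm"
  Mmult :: "'o \<Rightarrow> 'm"

text \<open>
  Morphisms of \<open>V\<close>-monads on the self-enriched \<open>V\<close>: \<open>V\<close>-natural families (naturality as the square
  \<open>[1, j\<^sub>B] S = [j\<^sub>A, 1] T\<close> out of \<open>[A,B]\<close>) compatible with units and multiplications.
\<close>

definition emonad_morphism ::
  "('o, 'm, 'z) smcc_scheme \<Rightarrow> ('o, 'm, 'm) emonad \<Rightarrow> ('o, 'm, 'm) emonad \<Rightarrow> ('o \<Rightarrow> 'm) \<Rightarrow> bool" where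
  "emonad_morphism V S T j \<longleftrightarrow>
     (\<forall>A \<in> Ob V. j A \<in> hom V (Mob S A) (Mob T A)) \<and>
     (\<forall>A \<in> Ob V. \<forall>B \<in> Ob V.
        Comp V (hmap V (Id V (Mob S A)) (j B)) (Mhom S A B)
        = Comp V (hmap V (j A) (Id V (Mob T B))) (Mhom T A B)) \<and>
     (\<forall>A \<in> Ob V. Comp V (j A) (Munit S A) = Munit T A) \<and>
     (\<forall>A \<in> Ob V. Comp V (j A) (Mmult S A)
        = Comp V (Mmult T A) (Comp V (Mar T (j A)) (j (Mob S A))))"

definition emonad_isomorphism ::
  "('o, 'm, 'z) smcc_scheme \<Rightarrow> ('o, 'm, 'm) emonad \<Rightarrow> ('o, 'm, 'm) emonad \<Rightarrow> ('o \<Rightarrow> 'm) \<Rightarrow> bool" where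
  "emonad_isomorphism V S T j \<longleftrightarrow> emonad_morphism V S T j \<and>
     (\<exists>k. emonad_morphism V T S k \<and>
        (\<forall>A \<in> Ob V. Comp V (k A) (j A) = Id V (Mob S A) \<and> Comp V (j A) (k A) = Id V (Mob T A)))"

text \<open>Change of base of a monad on the self-enriched \<open>L\<close> along \<open>G\<close>.\<close>

definition base_change ::
  "('l, 'b, 'x, 'a, 'w) mfunc_scheme \<Rightarrow> ('l, 'b, 'b) emonad \<Rightarrow> ('l, 'b, 'a) emonad" where
  "base_change G M =
     \<lparr>Mob = Mob M, Mar = Mar M, Mhom = (\<lambda>A B. far G (Mhom M A B)),
      Munit = Munit M, Mmult = Mmult M\<rparr>"

text \<open>
  The structure \<open>G(L(E,E')) \<rightarrow> X(G E, G E')\<close>, the transpose of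
  \<open>G E \<otimes> G(L(E,E')) \<rightarrow> G(E \<otimes> L(E,E')) \<rightarrow> G E'\<close>.
\<close>

definition right_adjoint_hom ::
  "('x, 'a, 'y) smcc_scheme \<Rightarrow> ('l, 'b, 'z) smcc_scheme \<Rightarrow> ('l, 'b, 'x, 'a, 'w) mfunc_scheme
    \<Rightarrow> 'l \<Rightarrow> 'l \<Rightarrow> 'a" where
  "right_adjoint_hom X L G E E' =
     curry X (fob G E) (fob G (ihom L E E')) (fob G E')
       (Comp X (far G (ev L E E')) (mult G E (ihom L E E')))"

text \<open>
  The structure \<open>X(A,B) \<rightarrow> G(L(F A, F B))\<close> of the left adjoint: the adjunct of the transpose
  \<open>F(X(A,B)) \<rightarrow> L(F A, F B)\<close> of \<open>F A \<otimes> F(X(A,B)) \<rightarrow> F(A \<otimes> X(A,B)) \<rightarrow> F B\<close>.  It is the unique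
  structure for which \<open>\<eta>\<close> is an \<open>X\<close>-natural unit.
\<close>

definition left_adjoint_hom ::
  "('x, 'a, 'y) smcc_scheme \<Rightarrow> ('l, 'b, 'z) smcc_scheme \<Rightarrow> ('x, 'a, 'l, 'b, 'v) mfunc_scheme
    \<Rightarrow> ('l, 'b, 'x, 'a, 'w) mfunc_scheme \<Rightarrow> ('x \<Rightarrow> 'a) \<Rightarrow> 'x \<Rightarrow> 'x \<Rightarrow> 'a" where
  "left_adjoint_hom X L F G \<eta> A B =
     Comp X
       (far G (curry L (fob F A) (fob F (ihom X A B)) (fob F B)
         (Comp L (far F (ev X A B)) (mult F A (ihom X A B)))))
       (\<eta> (ihom X A B))"

text \<open>The monad \<open>[F,G](M)\<close> on \<open>X\<close> with endofunctor \<open>G M F\<close>.\<close>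

definition induced_monad ::
  "('x, 'a, 'y) smcc_scheme \<Rightarrow> ('l, 'b, 'z) smcc_scheme \<Rightarrow> ('x, 'a, 'l, 'b, 'v) mfunc_scheme
    \<Rightarrow> ('l, 'b, 'x, 'a, 'w) mfunc_scheme \<Rightarrow> ('x \<Rightarrow> 'a) \<Rightarrow> ('l \<Rightarrow> 'b)
    \<Rightarrow> ('l, 'b, 'a) emonad \<Rightarrow> ('x, 'a, 'a) emonad" where
  "induced_monad X L F G \<eta> \<epsilon> M =
     \<lparr>Mob = (\<lambda>A. fob G (Mob M (fob F A))),
      Mar = (\<lambda>f. far G (Mar M (far F f))),
      Mhom = (\<lambda>A B. Comp X (right_adjoint_hom X L G (Mob M (fob F A)) (Mob M (fob F B)))
                 (Comp X (Mhom M (fob F A) (fob F B)) (left_adjoint_hom X L F G \<eta> A B))),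
      Munit = (\<lambda>A. Comp X (far G (Munit M (fob F A))) (\<eta> A)),
      Mmult = (\<lambda>A. Comp X (far G (Mmult M (fob F A)))
                          (far G (Mar M (\<epsilon> (Mob M (fob F A))))))\<rparr>"

section \<open>Double dualization and functional completeness\<close>

definition dual :: "('l, 'b, 'z) smcc_scheme \<Rightarrow> 'l \<Rightarrow> 'l" where
  "dual L E = ihom L E (Unit L)"

definition dual_map :: "('l, 'b, 'z) smcc_scheme \<Rightarrow> 'b \<Rightarrow> 'b" where
  "dual_map L h = hmap L h (Id L (Unit L))"

text \<open>The canonical \<open>E \<rightarrow> E**\<close>, the transpose of \<open>E* \<otimes> E \<cong> E \<otimes> E* \<rightarrow> R\<close>.\<close>

definition bidual_unit :: "('l, 'b, 'z) smcc_scheme \<Rightarrow> 'l \<Rightarrow> 'b" where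
  "bidual_unit L E =
     curry L (dual L E) E (Unit L) (Comp L (ev L E (Unit L)) (symm L (dual L E) E))"

definition reflexive :: "('l, 'b, 'z) smcc_scheme \<Rightarrow> 'l \<Rightarrow> bool" where
  "reflexive L E \<longleftrightarrow> is_iso L (bidual_unit L E)"

text \<open>
  The monad of the adjunction \<open>L(-,R) \<stileturn> L(-,R)\<close> between \<open>L\<^sup>o\<^sup>p\<close> and \<open>L\<close>, whose unit and
  counit both have the canonical morphisms \<open>E \<rightarrow> E**\<close> as components.
\<close>

definition bidual_monad :: "('l, 'b, 'z) smcc_scheme \<Rightarrow> ('l, 'b, 'b) emonad" where
  "bidual_monad L =
     \<lparr>Mob = (\<lambda>E. dual L (dual L E)),
      Mar = (\<lambda>h. dual_map L (dual_map L h)),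
      Mhom = (\<lambda>A B. Comp L (ihom_contra L (Unit L) (dual L B) (dual L A))
                           (ihom_contra L (Unit L) A B)),
      Munit = bidual_unit L,
      Mmult = (\<lambda>E. dual_map L (bidual_unit L (dual L E)))\<rparr>"

definition functionally_complete :: "('l, 'b, 'z) smcc_scheme \<Rightarrow> 'l \<Rightarrow> bool" where
  "functionally_complete L E \<longleftrightarrow> E \<in> Ob L \<and>
     (\<forall>h \<in> Ar L. is_iso L (dual_map L (dual_map L h)) \<longrightarrow> is_iso L (hmap L h (Id L E)))"

text \<open>
  \<open>d : E \<rightarrow> K\<close> is an \<open>L\<close>-enriched reflection of \<open>E\<close> into the functionally complete objects.
\<close>

definition fc_reflection :: "('l, 'b, 'z) smcc_scheme \<Rightarrow> 'l \<Rightarrow> 'l \<Rightarrow> 'b \<Rightarrow> bool" where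
  "fc_reflection L E K d \<longleftrightarrow> functionally_complete L K \<and> d \<in> hom L E K \<and>
     (\<forall>E'. functionally_complete L E' \<longrightarrow> is_iso L (hmap L d (Id L E')))"

text \<open>
  A choice of reflections; when \<open>L\<close> is finitely well-complete every object has one, and any two are
  uniquely isomorphic.
\<close>

definition completion :: "('l, 'b, 'z) smcc_scheme \<Rightarrow> 'l \<Rightarrow> 'l \<times> 'b" where
  "completion L E = (SOME r. fc_reflection L E (fst r) (snd r))"

definition completion_ob :: "('l, 'b, 'z) smcc_scheme \<Rightarrow> 'l \<Rightarrow> 'l" where
  "completion_ob L E = fst (completion L E)"

definition completion_unit :: "('l, 'b, 'z) smcc_scheme \<Rightarrow> 'l \<Rightarrow> 'b" where
  "completion_unit L E = snd (completion L E)"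

text \<open>The idempotent monad of the reflection; its structure is forced by the universal property.\<close>

definition completion_monad :: "('l, 'b, 'z) smcc_scheme \<Rightarrow> ('l, 'b, 'b) emonad" where
  "completion_monad L =
     \<lparr>Mob = completion_ob L,
      Mar = (\<lambda>h. THE g. g \<in> hom L (completion_ob L (Dom L h)) (completion_ob L (Cod L h)) \<and>
                  Comp L g (completion_unit L (Dom L h)) = Comp L (completion_unit L (Cod L h)) h),
      Mhom = (\<lambda>A B. Comp L
                (inverse_of L (hmap L (completion_unit L A) (Id L (completion_ob L B))))
                (hmap L (Id L A) (completion_unit L B))),
      Munit = completion_unit L,
      Mmult = (\<lambda>E. THE g. g \<in> hom L (completion_ob L (completion_ob L E)) (completion_ob L E) \<and>
                  Comp L g (completion_unit L (completion_ob L E)) = Id L (completion_ob L E))\<rparr>"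

definition completion_embedding :: "('l, 'b, 'z) smcc_scheme \<Rightarrow> 'l \<Rightarrow> 'b" where
  "completion_embedding L E =
     (THE i. i \<in> hom L (completion_ob L E) (dual L (dual L E)) \<and>
             Comp L i (completion_unit L E) = bidual_unit L E)"

section \<open>Distribution monads\<close>

text \<open>The cotensor \<open>[A,E]\<close> in the change of base of \<open>L\<close> along \<open>G\<close>.\<close>

definition cotensor ::
  "('l, 'b, 'z) smcc_scheme \<Rightarrow> ('x, 'a, 'l, 'b, 'v) mfunc_scheme \<Rightarrow> 'x \<Rightarrow> 'l \<Rightarrow> 'l" where
  "cotensor L F A E = ihom L (fob F A) E"

text \<open>
  The monad of \<open>[-,R] \<stileturn> G(L(-,R))\<close>, which is \<open>[F,G]\<close> of the double-dualization monad because
  \<open>[A,R] = L(F A, R)\<close>.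
\<close>

definition natural_distribution_monad ::
  "('x, 'a, 'y) smcc_scheme \<Rightarrow> ('l, 'b, 'z) smcc_scheme \<Rightarrow> ('x, 'a, 'l, 'b, 'v) mfunc_scheme
    \<Rightarrow> ('l, 'b, 'x, 'a, 'w) mfunc_scheme \<Rightarrow> ('x \<Rightarrow> 'a) \<Rightarrow> ('l \<Rightarrow> 'b) \<Rightarrow> ('x, 'a, 'a) emonad" where
  "natural_distribution_monad X L F G \<eta> \<epsilon> =
     induced_monad X L F G \<eta> \<epsilon> (base_change G (bidual_monad L))"

definition accessible_distribution_monad ::
  "('x, 'a, 'y) smcc_scheme \<Rightarrow> ('l, 'b, 'z) smcc_scheme \<Rightarrow> ('x, 'a, 'l, 'b, 'v) mfunc_scheme
    \<Rightarrow> ('l, 'b, 'x, 'a, 'w) mfunc_scheme \<Rightarrow> ('x \<Rightarrow> 'a) \<Rightarrow> ('l \<Rightarrow> 'b) \<Rightarrow> ('x, 'a, 'a) emonad" where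
  "accessible_distribution_monad X L F G \<eta> \<epsilon> =
     induced_monad X L F G \<eta> \<epsilon> (base_change G (completion_monad L))"

definition distribution_comparison ::
  "('l, 'b, 'z) smcc_scheme \<Rightarrow> ('x, 'a, 'l, 'b, 'v) mfunc_scheme
    \<Rightarrow> ('l, 'b, 'x, 'a, 'w) mfunc_scheme \<Rightarrow> 'x \<Rightarrow> 'a" where
  "distribution_comparison L F G A = far G (completion_embedding L (fob F A))"

end

(*
  Write d : E --> E** for the canonical morphism.  By the triangle identity, h* is a retract of
  h***, so a morphism with invertible bidual has invertible dual; hence every dual Z* is
  functionally complete.  If E* is reflexive, the same triangle identity makes d* the inverse of
  the canonical morphism of E*, so d** is invertible and d inverts every internal hom into a
  functionally complete object.  Thus E** with d is itself a functional completion of E, and the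
  comparison of the completion with E** is invertible.  For E = F A the dual is the cotensor [A,R],
  and applying G to the inverses gives the inverse morphism of monads.
*)

theory Submission
  imports Defs
begin

section \<open>Categories\<close>

text \<open>Functional completeness concerns the internal hom \<open>[h,K]\<close>, so unique
  extension of arrows \<open>E\<^sub>1 \<rightarrow> K\<close> along \<open>h\<close> says too
  little. Yoneda supplies the right form: \<open>[h,K]\<close> is invertible exactly when, for every
  object \<open>D\<close>, arrows \<open>E\<^sub>1 \<otimes> D \<rightarrow> K\<close> extend
  uniquely along \<open>h \<otimes> D\<close>. The unit object as \<open>D\<close> gives the
  universal property of a reflection. Replacing \<open>D\<close> by \<open>D \<otimes> Z\<close>
  carries invertibility from \<open>[h,K]\<close> to \<open>[h,[Z,K]]\<close>, which is how an
  invertible dual of \<open>h\<close> yields functional completeness of the dual of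
  \<open>Z\<close>. The completion is a choice among reflections, so the proof uses it only at
  objects for which some reflection has been exhibited. An isomorphism of enriched monads also
  requires the inverse family to respect hom-objects and multiplications. Equations of arrows
  leaving a reflection are tested on its unit, where a multiplication following the action on an
  arrow collapses to that arrow. Enriched naturality of the bidual unit has no such shortcut; the
  hexagon enters there.\<close>

lemma bij_betw_ex1_iff:
  assumes "bij_betw f {x. P x} {y. Q y}"
  shows "(\<exists>!x. P x) \<longleftrightarrow> (\<exists>!y. Q y)"
  using bij_betw_same_card[OF assms] is_singleton_iff_ex1[of "{x. P x}"] is_singleton_iff_ex1[of "{y. Q y}"]
  by (simp add: is_singleton_altdef)

context category
begin

section \<open>Composition calculus and isomorphisms\<close>

lemma in_hom_iff: "f \<in> hom C A B \<longleftrightarrow> f \<in> Ar C \<and> Dom C f = A \<and> Cod C f = B"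
  by (auto simp: hom_def)

lemma in_homI [intro]: "f \<in> Ar C \<Longrightarrow> Dom C f = A \<Longrightarrow> Cod C f = B \<Longrightarrow> f \<in> hom C A B"
  by (simp add: in_hom_iff)

lemma Id_arr [simp]:
  assumes "A \<in> Ob C"
  shows "Id C A \<in> Ar C" "Dom C (Id C A) = A" "Cod C (Id C A) = A"
  using Id_hom[OF assms] by (simp_all add: in_hom_iff)

lemma Comp_arr [simp]:
  assumes "f \<in> Ar C" "g \<in> Ar C" "Dom C g = Cod C f"
  shows "g \<cdot> f \<in> Ar C" "Dom C (g \<cdot> f) = Dom C f" "Cod C (g \<cdot> f) = Cod C g"
  using Comp_hom[of f "Dom C f" "Cod C f" g "Cod C g"] assms by (simp_all add: in_hom_iff)

lemma Comp_Id_arr [simp]: "f \<in> Ar C \<Longrightarrow> Dom C f = A \<Longrightarrow> f \<cdot> Id C A = f"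
  using Comp_Id[of f A "Cod C f"] by (simp add: in_hom_iff)

lemma Id_Comp_arr [simp]: "f \<in> Ar C \<Longrightarrow> Cod C f = A \<Longrightarrow> Id C A \<cdot> f = f"
  using Id_Comp[of f "Dom C f" A] by (simp add: in_hom_iff)

lemma Comp_assoc_arr [simp]:
  assumes "f \<in> Ar C" "g \<in> Ar C" "h \<in> Ar C" "Dom C g = Cod C f" "Dom C h = Cod C g"
  shows "(h \<cdot> g) \<cdot> f = h \<cdot> (g \<cdot> f)"
  using Comp_assoc[of f "Dom C f" "Cod C f" g "Cod C g" h "Cod C h"] assms
  by (simp add: in_hom_iff)

lemma is_isoI:
  assumes "f \<in> hom C A B" "g \<in> hom C B A" "g \<cdot> f = Id C A" "f \<cdot> g = Id C B"
  shows "is_iso C f"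
  using assms unfolding is_iso_def are_inverse_def by (auto simp: in_hom_iff)

lemma is_isoE:
  assumes "is_iso C f" "f \<in> hom C A B"
  obtains g where "g \<in> hom C B A" "g \<cdot> f = Id C A" "f \<cdot> g = Id C B"
  using assms unfolding is_iso_def are_inverse_def by (auto simp: in_hom_iff)

lemma is_iso_Id: "A \<in> Ob C \<Longrightarrow> is_iso C (Id C A)"
  by (rule is_isoI[of _ A A "Id C A"]) auto

lemma are_inverse_inverse_of:
  assumes "is_iso C f"
  shows "are_inverse C f (inverse_of C f)"
proof -
  obtain g where g: "are_inverse C f g"
    using assms unfolding is_iso_def by blast
  have "g' = g" if "are_inverse C f g'" for g'
  proof -
    have "(g' \<cdot> f) \<cdot> g = g' \<cdot> (f \<cdot> g)"
      using g that by (intro Comp_assoc_arr) (auto simp: are_inverse_def in_hom_iff)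
    then show ?thesis
      using g that by (simp add: are_inverse_def in_hom_iff del: Comp_assoc_arr)
  qed
  with g show ?thesis
    unfolding inverse_of_def by (rule theI)
qed

lemma inverse_of_arr:
  assumes "is_iso C f"
  shows "inverse_of C f \<in> Ar C" "Dom C (inverse_of C f) = Cod C f"
    "Cod C (inverse_of C f) = Dom C f"
    "inverse_of C f \<cdot> f = Id C (Dom C f)" "f \<cdot> inverse_of C f = Id C (Cod C f)"
  using are_inverse_inverse_of[OF assms] by (simp_all add: are_inverse_def in_hom_iff)

text \<open>Simplification with \<open>Comp_assoc_arr\<close> nests composites to the right, which
  hides the left-hand side of a known equation \<open>g \<cdot> f = k\<close>. This form applies the
  equation in front of a remaining factor \<open>x\<close>.\<close>

lemma Comp_eq_extend:
  assumes "g \<cdot> f = k" "f \<in> Ar C" "g \<in> Ar C" "Dom C g = Cod C f" "x \<in> Ar C" "Cod C x = Dom C f"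
  shows "g \<cdot> (f \<cdot> x) = k \<cdot> x"
  using Comp_assoc_arr[of x f g] assms by (simp del: Comp_assoc_arr)

lemma iso_right_cancel:
  assumes "is_iso C f" "f \<in> hom C A B" "u \<in> hom C B D" "v \<in> hom C B D" "u \<cdot> f = v \<cdot> f"
  shows "u = v"
proof -
  obtain g where g: "g \<in> hom C B A" "f \<cdot> g = Id C B"
    using assms(1,2) by (rule is_isoE)
  have "u \<cdot> (f \<cdot> g) = v \<cdot> (f \<cdot> g)"
    using Comp_assoc[OF g(1) assms(2,3)] Comp_assoc[OF g(1) assms(2,4)] assms(5) by simp
  then show ?thesis
    using g assms by (simp add: in_hom_iff)
qed

lemma iso_left_cancel:
  assumes "is_iso C f" "f \<in> hom C A B" "u \<in> hom C D A" "v \<in> hom C D A" "f \<cdot> u = f \<cdot> v"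
  shows "u = v"
proof -
  obtain g where g: "g \<in> hom C B A" "g \<cdot> f = Id C A"
    using assms(1,2) by (rule is_isoE)
  have "(g \<cdot> f) \<cdot> u = (g \<cdot> f) \<cdot> v"
    using Comp_assoc[OF assms(3,2) g(1)] Comp_assoc[OF assms(4,2) g(1)] assms(5) by simp
  then show ?thesis
    using g assms by (simp add: in_hom_iff)
qed

text \<open>Yoneda for representables. In the converse, \<open>g\<close> is the solution of
  \<open>f \<cdot> g = Id C B\<close>; then \<open>g \<cdot> f\<close> and \<open>Id C A\<close>
  both solve \<open>f \<cdot> u = f\<close> and so coincide.\<close>

lemma is_iso_iff_postcomp_bij:
  assumes f: "f \<in> hom C A B"
  shows "is_iso C f \<longleftrightarrow> (\<forall>D \<in> Ob C. \<forall>v \<in> hom C D B. \<exists>!u. u \<in> hom C D A \<and> f \<cdot> u = v)"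
proof
  assume iso: "is_iso C f"
  then obtain g where g: "g \<in> hom C B A" "f \<cdot> g = Id C B"
    using f by (rule is_isoE)
  show "\<forall>D \<in> Ob C. \<forall>v \<in> hom C D B. \<exists>!u. u \<in> hom C D A \<and> f \<cdot> u = v"
  proof (intro ballI ex_ex1I)
    fix D v assume v: "v \<in> hom C D B"
    have "f \<cdot> (g \<cdot> v) = v"
      using Comp_assoc[OF v g(1) f] g(2) Id_Comp[OF v] by simp
    then show "\<exists>u. u \<in> hom C D A \<and> f \<cdot> u = v"
      using Comp_hom[OF v g(1)] by blast
  qed (use iso_left_cancel[OF iso f] in auto)
next
  assume *: "\<forall>D \<in> Ob C. \<forall>v \<in> hom C D B. \<exists>!u. u \<in> hom C D A \<and> f \<cdot> u = v"
  have A: "A \<in> Ob C" and B: "B \<in> Ob C"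
    using f Dom_Ob Cod_Ob by (auto simp: in_hom_iff)
  obtain g where g: "g \<in> hom C B A" "f \<cdot> g = Id C B"
    using * B Id_hom[OF B] by blast
  have "f \<cdot> (g \<cdot> f) = f \<cdot> Id C A"
    using Comp_assoc[OF f g(1) f] g(2) Id_Comp[OF f] Comp_Id[OF f] by simp
  then have "g \<cdot> f = Id C A"
    using * A f Comp_hom[OF f g(1)] Id_hom[OF A] Comp_hom[OF Id_hom[OF A] f] by metis
  with f g show "is_iso C f"
    by (blast intro: is_isoI)
qed

end

section \<open>Closed symmetric monoidal categories\<close>

context closed_symmetric_monoidal_category
begin

declare Unit_Ob [simp] tens_Ob [simp] ihom_Ob [simp] tensa_Id [simp]

lemma tensa_arr [simp]:
  assumes "f \<in> Ar V" "g \<in> Ar V"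
  shows "f \<odot> g \<in> Ar V" "Dom V (f \<odot> g) = Dom V f \<otimes> Dom V g"
    "Cod V (f \<odot> g) = Cod V f \<otimes> Cod V g"
  using tensa_hom[of f "Dom V f" "Cod V f" g "Dom V g" "Cod V g"] assms
  by (simp_all add: in_hom_iff)

lemma tensa_interchange [simp]:
  assumes "f \<in> Ar V" "f' \<in> Ar V" "g \<in> Ar V" "g' \<in> Ar V" "Dom V f' = Cod V f" "Dom V g' = Cod V g"
  shows "(f' \<odot> g') \<cdot> (f \<odot> g) = (f' \<cdot> f) \<odot> (g' \<cdot> g)"
  using tensa_Comp[of f "Dom V f" "Cod V f" f' "Cod V f'" g "Dom V g" "Cod V g" g' "Cod V g'"]
    assms by (simp add: in_hom_iff)

lemma tensa_interchange_extend [simp]: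
  assumes "f \<in> Ar V" "f' \<in> Ar V" "g \<in> Ar V" "g' \<in> Ar V" "Dom V f' = Cod V f" "Dom V g' = Cod V g"
    "x \<in> Ar V" "Cod V x = Dom V f \<otimes> Dom V g"
  shows "(f' \<odot> g') \<cdot> ((f \<odot> g) \<cdot> x) = ((f' \<cdot> f) \<odot> (g' \<cdot> g)) \<cdot> x"
  using assms by (intro Comp_eq_extend) auto

lemma structure_arr [simp]:
  assumes "A \<in> Ob V" "B \<in> Ob V"
  shows "symm V A B \<in> Ar V" "Dom V (symm V A B) = A \<otimes> B" "Cod V (symm V A B) = B \<otimes> A"
    "ev V A B \<in> Ar V" "Dom V (ev V A B) = A \<otimes> ihom V A B" "Cod V (ev V A B) = B"
  using symm_hom[OF assms] ev_hom[OF assms] by (simp_all add: in_hom_iff)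

lemma assc_arr [simp]:
  assumes "A \<in> Ob V" "B \<in> Ob V" "D \<in> Ob V"
  shows "assc V A B D \<in> Ar V" "Dom V (assc V A B D) = (A \<otimes> B) \<otimes> D"
    "Cod V (assc V A B D) = A \<otimes> (B \<otimes> D)"
  using assc_hom[OF assms] by (simp_all add: in_hom_iff)

abbreviation assc_inv :: "'o \<Rightarrow> 'o \<Rightarrow> 'o \<Rightarrow> 'm" where
  "assc_inv A B D \<equiv> inverse_of V (assc V A B D)"

lemma assc_inv_arr [simp]:
  assumes "A \<in> Ob V" "B \<in> Ob V" "D \<in> Ob V"
  shows "assc_inv A B D \<in> Ar V" "Dom V (assc_inv A B D) = A \<otimes> (B \<otimes> D)"
    "Cod V (assc_inv A B D) = (A \<otimes> B) \<otimes> D"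
    "assc_inv A B D \<cdot> assc V A B D = Id V ((A \<otimes> B) \<otimes> D)"
    "assc V A B D \<cdot> assc_inv A B D = Id V (A \<otimes> (B \<otimes> D))"
  using inverse_of_arr[OF assc_iso[OF assms]] assms by simp_all

lemma symm_natural_arr:
  assumes "f \<in> Ar V" "g \<in> Ar V" "Cod V f = A'" "Cod V g = B'"
  shows "symm V A' B' \<cdot> (f \<odot> g) = (g \<odot> f) \<cdot> symm V (Dom V f) (Dom V g)"
  using symm_natural[of f "Dom V f" A' g "Dom V g" B'] assms by (simp add: in_hom_iff)

lemma assc_inv_natural:
  assumes "f \<in> Ar V" "g \<in> Ar V" "h \<in> Ar V" "Cod V f = A" "Cod V g = B" "Cod V h = D"
  shows "assc_inv A B D \<cdot> (f \<odot> (g \<odot> h))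
    = ((f \<odot> g) \<odot> h) \<cdot> assc_inv (Dom V f) (Dom V g) (Dom V h)"
proof -
  have [simp]: "Dom V f \<in> Ob V" "Dom V g \<in> Ob V" "Dom V h \<in> Ob V" "A \<in> Ob V" "B \<in> Ob V" "D \<in> Ob V"
    using assms by (auto simp: Dom_Ob Cod_Ob)
  have nat: "assc V A B D \<cdot> ((f \<odot> g) \<odot> h)
      = (f \<odot> (g \<odot> h)) \<cdot> assc V (Dom V f) (Dom V g) (Dom V h)"
    using assms by (intro assc_natural) (auto simp: in_hom_iff)
  have 1: "assc V A B D \<cdot> (((f \<odot> g) \<odot> h) \<cdot> assc_inv (Dom V f) (Dom V g) (Dom V h))
      = f \<odot> (g \<odot> h)"
    using assms by (subst Comp_eq_extend[OF nat]) auto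
  have 2: "assc V A B D \<cdot> (assc_inv A B D \<cdot> (f \<odot> (g \<odot> h))) = f \<odot> (g \<odot> h)"
    using assms by (subst Comp_eq_extend[OF assc_inv_arr(5)]) auto
  have 3: "assc_inv A B D \<cdot> (f \<odot> (g \<odot> h)) \<in> hom V (Dom V (f \<odot> (g \<odot> h))) ((A \<otimes> B) \<otimes> D)"
    "((f \<odot> g) \<odot> h) \<cdot> assc_inv (Dom V f) (Dom V g) (Dom V h)
      \<in> hom V (Dom V (f \<odot> (g \<odot> h))) ((A \<otimes> B) \<otimes> D)"
    using assms by (simp_all add: in_hom_iff)
  show ?thesis
    using iso_left_cancel[OF assc_iso assc_hom 3 trans[OF 2 1[symmetric]]] by simp
qed

section \<open>Transposition and the action of the internal hom\<close>

lemma curry_arr [simp]: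
  assumes "A \<in> Ob V" "B \<in> Ob V" "D \<in> Ob V" "f \<in> Ar V" "Dom V f = A \<otimes> D" "Cod V f = B"
  shows "curry V A D B f \<in> Ar V" "Dom V (curry V A D B f) = D"
    "Cod V (curry V A D B f) = ihom V A B"
    and ev_curry_Id: "ev V A B \<cdot> (Id V A \<odot> curry V A D B f) = f"
proof -
  have "f \<in> hom V (A \<otimes> D) B"
    using assms by auto
  from theI'[OF ev_universal[OF assms(1-3) this]]
  have "curry V A D B f \<in> hom V D (ihom V A B) \<and> ev V A B \<cdot> (Id V A \<odot> curry V A D B f) = f"
    unfolding curry_def .
  then show "curry V A D B f \<in> Ar V" "Dom V (curry V A D B f) = D"
    "Cod V (curry V A D B f) = ihom V A B" "ev V A B \<cdot> (Id V A \<odot> curry V A D B f) = f"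
    by (auto simp: in_hom_iff)
qed

text \<open>The uniqueness half of \<open>ev_universal\<close>. Equations between arrows into an
  internal hom are reduced by it to equations between arrows out of a tensor product.\<close>

lemma ihom_ext:
  assumes "A \<in> Ob V" "B \<in> Ob V" "g \<in> hom V D (ihom V A B)" "g' \<in> hom V D (ihom V A B)"
    and eq: "ev V A B \<cdot> (Id V A \<odot> g) = ev V A B \<cdot> (Id V A \<odot> g')"
  shows "g = g'"
proof -
  have D: "D \<in> Ob V"
    using assms(3) Dom_Ob[of g] by (simp add: in_hom_iff)
  have "ev V A B \<cdot> (Id V A \<odot> g) \<in> hom V (A \<otimes> D) B"
    using assms(1-3) by (simp add: in_hom_iff)
  note the1_equality[OF ev_universal[OF assms(1,2) D this]]
  from this[OF conjI, OF assms(3) refl] this[OF conjI, OF assms(4) eq[symmetric]]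
  show ?thesis
    by (rule trans[OF sym])
qed

text \<open>The free arrows \<open>h\<close> and \<open>g\<close> combine the beta rule with
  naturality in both tensor factors, so that the rule still matches in the middle of a
  computation.\<close>

lemma ev_curry:
  assumes "A \<in> Ob V" "B \<in> Ob V" "D \<in> Ob V" "f \<in> Ar V" "Dom V f = A \<otimes> D" "Cod V f = B"
    and "h \<in> Ar V" "Cod V h = A" "g \<in> Ar V" "Cod V g = D"
  shows "ev V A B \<cdot> (h \<odot> (curry V A D B f \<cdot> g)) = f \<cdot> (h \<odot> g)"
proof -
  have "ev V A B \<cdot> (h \<odot> (curry V A D B f \<cdot> g))
      = ev V A B \<cdot> ((Id V A \<odot> curry V A D B f) \<cdot> (h \<odot> g))"
    using assms by simp
  also have "\<dots> = f \<cdot> (h \<odot> g)"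
    using assms by (intro Comp_eq_extend ev_curry_Id) auto
  finally show ?thesis .
qed

lemma hmap_arr [simp]:
  assumes "h \<in> Ar V" "f \<in> Ar V"
  shows "hmap V h f \<in> Ar V" "Dom V (hmap V h f) = ihom V (Cod V h) (Dom V f)"
    "Cod V (hmap V h f) = ihom V (Dom V h) (Cod V f)"
  using assms by (simp_all add: hmap_def Let_def Dom_Ob Cod_Ob)

text \<open>Evaluation consumes \<open>hmap\<close> by moving its contravariant part
  \<open>h\<close> to the argument side, next to \<open>k\<close>, and its covariant part
  \<open>f\<close> to the outside.\<close>

lemma ev_hmap:
  assumes "h \<in> Ar V" "f \<in> Ar V" "Dom V h = A" "Cod V f = B"
    and "k \<in> Ar V" "Cod V k = A" "g \<in> Ar V" "Cod V g = ihom V (Cod V h) (Dom V f)"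
  shows "ev V A B \<cdot> (k \<odot> (hmap V h f \<cdot> g))
    = f \<cdot> (ev V (Cod V h) (Dom V f) \<cdot> ((h \<cdot> k) \<odot> g))"
proof -
  have [simp]: "A \<in> Ob V" "B \<in> Ob V" "Cod V h \<in> Ob V" "Dom V f \<in> Ob V"
    using assms by (auto simp: Dom_Ob Cod_Ob)
  show ?thesis
    unfolding hmap_def Let_def assms(3,4) using assms by (subst ev_curry) auto
qed

lemma ev_hmap':
  assumes "h \<in> Ar V" "f \<in> Ar V" "Dom V h = A" "Cod V f = B" "k \<in> Ar V" "Cod V k = A"
  shows "ev V A B \<cdot> (k \<odot> hmap V h f)
    = f \<cdot> (ev V (Cod V h) (Dom V f) \<cdot> ((h \<cdot> k) \<odot> Id V (ihom V (Cod V h) (Dom V f))))"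
  using ev_hmap[OF assms, of "Id V (ihom V (Cod V h) (Dom V f))"] assms
  by (simp add: Dom_Ob Cod_Ob)

lemma hmap_Id [simp]:
  assumes "A \<in> Ob V" "B \<in> Ob V"
  shows "hmap V (Id V A) (Id V B) = Id V (ihom V A B)"
  by (rule ihom_ext[of A B _ "ihom V A B"]) (use assms in \<open>auto simp: ev_hmap'\<close>)

lemma hmap_Comp:
  assumes "h \<in> Ar V" "h' \<in> Ar V" "Cod V h' = Dom V h"
    "f \<in> Ar V" "f' \<in> Ar V" "Dom V f' = Cod V f"
  shows "hmap V h' f' \<cdot> hmap V h f = hmap V (h \<cdot> h') (f' \<cdot> f)"
  by (rule ihom_ext[of "Dom V h'" "Cod V f'" _ "ihom V (Cod V h) (Dom V f)"])
    (use assms in \<open>auto simp: ev_hmap' ev_hmap Dom_Ob Cod_Ob\<close>)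

section \<open>The bidual\<close>

lemma inverse_cancel_left [simp]:
  assumes "A \<in> Ob V" "B \<in> Ob V" "x \<in> Ar V"
  shows "D \<in> Ob V \<Longrightarrow> Cod V x = (A \<otimes> B) \<otimes> D \<Longrightarrow> assc_inv A B D \<cdot> (assc V A B D \<cdot> x) = x"
    "D \<in> Ob V \<Longrightarrow> Cod V x = A \<otimes> (B \<otimes> D) \<Longrightarrow> assc V A B D \<cdot> (assc_inv A B D \<cdot> x) = x"
    "Cod V x = A \<otimes> B \<Longrightarrow> symm V B A \<cdot> (symm V A B \<cdot> x) = x"
  using assms Comp_eq_extend[OF assc_inv_arr(4)] Comp_eq_extend[OF assc_inv_arr(5)]
    Comp_eq_extend[OF symm_symm] by simp_all

declare symm_symm [simp]

text \<open>Two hexagons suffice. The one for \<open>Q\<close>, \<open>P\<close>, \<open>S\<close>,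
  freed of its last symmetry, rewrites the composite after it is precomposed with
  \<open>assc V P Q S\<close>; two inverse pairs cancel, and what is left is the right-hand side of
  the hexagon for \<open>P\<close>, \<open>Q\<close>, \<open>S\<close>.\<close>

lemma symm_tens:
  assumes [simp]: "P \<in> Ob V" "Q \<in> Ob V" "S \<in> Ob V"
  shows "assc_inv Q S P \<cdot> ((Id V Q \<odot> symm V P S) \<cdot> (symm V (P \<otimes> S) Q \<cdot>
      (assc_inv P S Q \<cdot> (Id V P \<odot> symm V Q S)))) = symm V P (Q \<otimes> S)"
proof -
  have "(assc V P S Q \<cdot> symm V Q (P \<otimes> S) \<cdot> assc V Q P S) \<cdot> (symm V P Q \<odot> Id V S)
      = ((Id V P \<odot> symm V Q S) \<cdot> assc V P Q S \<cdot> (symm V Q P \<odot> Id V S)) \<cdot> (symm V P Q \<odot> Id V S)"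
    by (simp only: hexagon[of Q P S, OF assms(2,1,3)])
  then have "(Id V P \<odot> symm V Q S) \<cdot> assc V P Q S
      = assc V P S Q \<cdot> symm V Q (P \<otimes> S) \<cdot> assc V Q P S \<cdot> (symm V P Q \<odot> Id V S)"
    by simp
  then have "(assc_inv Q S P \<cdot> ((Id V Q \<odot> symm V P S) \<cdot> (symm V (P \<otimes> S) Q \<cdot>
      (assc_inv P S Q \<cdot> (Id V P \<odot> symm V Q S))))) \<cdot> assc V P Q S
    = assc_inv Q S P \<cdot> ((Id V Q \<odot> symm V P S) \<cdot> assc V Q P S \<cdot> (symm V P Q \<odot> Id V S))"
    by simp
  also have "\<dots> = symm V P (Q \<otimes> S) \<cdot> assc V P Q S"
    unfolding hexagon[of P Q S, OF assms, symmetric] by simp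
  finally show ?thesis
    by (rule iso_right_cancel[OF assc_iso assc_hom, rotated -1]) (auto simp: in_hom_iff)
qed

lemma icomp_arr [simp]:
  assumes "A \<in> Ob V" "B \<in> Ob V" "D \<in> Ob V"
  shows "icomp V A B D \<in> Ar V" "Dom V (icomp V A B D) = ihom V B D \<otimes> ihom V A B"
    "Cod V (icomp V A B D) = ihom V A D"
  using assms by (simp_all add: icomp_def)

text \<open>\<open>icomp\<close> takes its factors in the order of composition, while evaluation
  feeds the argument to the inner factor first. This mismatch is the source of the symmetry here and
  of the coherence problem settled by \<open>symm_tens\<close>.\<close>

lemma ev_icomp:
  assumes "A \<in> Ob V" "B \<in> Ob V" "D \<in> Ob V" "h \<in> Ar V" "Cod V h = A"
    "g \<in> Ar V" "Cod V g = ihom V B D \<otimes> ihom V A B"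
  shows "ev V A D \<cdot> (h \<odot> (icomp V A B D \<cdot> g))
    = ev V B D \<cdot> ((ev V A B \<odot> Id V (ihom V B D)) \<cdot> (assc_inv A (ihom V A B) (ihom V B D) \<cdot>
        (h \<odot> (symm V (ihom V B D) (ihom V A B) \<cdot> g))))"
  using assms unfolding icomp_def by (subst ev_curry) simp_all

lemma ihom_contra_arr [simp]:
  assumes "A \<in> Ob V" "B \<in> Ob V" "D \<in> Ob V"
  shows "ihom_contra V D A B \<in> Ar V" "Dom V (ihom_contra V D A B) = ihom V A B"
    "Cod V (ihom_contra V D A B) = ihom V (ihom V B D) (ihom V A D)"
  using assms by (simp_all add: ihom_contra_def)

lemma ev_ihom_contra:
  assumes "A \<in> Ob V" "B \<in> Ob V" "D \<in> Ob V" "h \<in> Ar V" "Cod V h = ihom V B D"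
    "g \<in> Ar V" "Cod V g = ihom V A B"
  shows "ev V (ihom V B D) (ihom V A D) \<cdot> (h \<odot> (ihom_contra V D A B \<cdot> g)) = icomp V A B D \<cdot> (h \<odot> g)"
  using assms unfolding ihom_contra_def by (subst ev_curry) simp_all

section \<open>The dual functor and the bidual unit\<close>

lemma dual_Ob [simp]: "A \<in> Ob V \<Longrightarrow> dual V A \<in> Ob V"
  by (simp add: dual_def)

lemma dual_map_arr [simp]:
  assumes "f \<in> Ar V"
  shows "dual_map V f \<in> Ar V" "Dom V (dual_map V f) = dual V (Cod V f)"
    "Cod V (dual_map V f) = dual V (Dom V f)"
  using assms by (simp_all add: dual_map_def dual_def)

lemma dual_map_Id [simp]: "A \<in> Ob V \<Longrightarrow> dual_map V (Id V A) = Id V (dual V A)"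
  by (simp add: dual_map_def dual_def)

lemma dual_map_Comp:
  "f \<in> Ar V \<Longrightarrow> g \<in> Ar V \<Longrightarrow> Dom V g = Cod V f \<Longrightarrow> dual_map V (g \<cdot> f) = dual_map V f \<cdot> dual_map V g"
  by (simp add: dual_map_def hmap_Comp)

lemma ev_dual_map:
  assumes "f \<in> Ar V" "Dom V f = A" "k \<in> Ar V" "Cod V k = A" "g \<in> Ar V" "Cod V g = dual V (Cod V f)"
  shows "ev V A (Unit V) \<cdot> (k \<odot> (dual_map V f \<cdot> g)) = ev V (Cod V f) (Unit V) \<cdot> ((f \<cdot> k) \<odot> g)"
  using assms ev_hmap[of f "Id V (Unit V)" A "Unit V" k g] Cod_Ob[of f] Dom_Ob[of f]
  by (simp add: dual_map_def dual_def)

lemma bidual_unit_arr [simp]: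
  assumes "E \<in> Ob V"
  shows "bidual_unit V E \<in> Ar V" "Dom V (bidual_unit V E) = E"
    "Cod V (bidual_unit V E) = dual V (dual V E)"
  using assms by (simp_all add: bidual_unit_def dual_def)

text \<open>\<open>bidual_unit\<close> transposes evaluation with its two factors swapped.
  Naturality moves the symmetry to the far right, where a second one can cancel it.\<close>

lemma ev_bidual_unit:
  assumes "E \<in> Ob V" "h \<in> Ar V" "Cod V h = dual V E" "g \<in> Ar V" "Cod V g = E"
  shows "ev V (dual V E) (Unit V) \<cdot> (h \<odot> (bidual_unit V E \<cdot> g))
    = ev V E (Unit V) \<cdot> ((g \<odot> h) \<cdot> symm V (Dom V h) (Dom V g))"
proof -
  have "Dom V h \<in> Ob V" "Dom V g \<in> Ob V"
    using assms Dom_Ob by auto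
  with assms have "ev V (dual V E) (Unit V) \<cdot> (h \<odot> (bidual_unit V E \<cdot> g))
      = ev V E (Unit V) \<cdot> (symm V (dual V E) E \<cdot> (h \<odot> g))"
    unfolding bidual_unit_def by (subst ev_curry) (simp_all add: dual_def)
  with assms show ?thesis
    by (simp add: symm_natural_arr)
qed

text \<open>Evaluated against \<open>dual V B\<close>, both composites become evaluation at
  \<open>B\<close> after applying \<open>f\<close>, with the two factors swapped.\<close>

lemma bidual_unit_natural:
  assumes f: "f \<in> Ar V" "Dom V f = A" "Cod V f = B"
  shows "dual_map V (dual_map V f) \<cdot> bidual_unit V A = bidual_unit V B \<cdot> f"
proof -
  have [simp]: "A \<in> Ob V" "B \<in> Ob V"
    using f Dom_Ob[of f] Cod_Ob[of f] by auto
  have "ev V (dual V B) (Unit V) \<cdot> (Id V (dual V B) \<odot> (dual_map V (dual_map V f) \<cdot> bidual_unit V A))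
      = ev V (dual V A) (Unit V) \<cdot> (dual_map V f \<odot> (bidual_unit V A \<cdot> Id V A))"
    using f by (subst ev_dual_map) simp_all
  also have "\<dots> = ev V A (Unit V) \<cdot> ((Id V A \<odot> (dual_map V f \<cdot> Id V (dual V B))) \<cdot> symm V (dual V B) A)"
    using f by (subst ev_bidual_unit) simp_all
  also have "\<dots> = (ev V A (Unit V) \<cdot> (Id V A \<odot> (dual_map V f \<cdot> Id V (dual V B)))) \<cdot> symm V (dual V B) A"
    using f by (subst Comp_assoc_arr) (simp_all add: dual_def)
  also have "\<dots> = (ev V B (Unit V) \<cdot> (f \<odot> Id V (dual V B))) \<cdot> symm V (dual V B) A"
    using f by (subst ev_dual_map) simp_all
  also have "\<dots> = ev V (dual V B) (Unit V) \<cdot> (Id V (dual V B) \<odot> (bidual_unit V B \<cdot> f))"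
    using f by (subst ev_bidual_unit) (simp_all add: dual_def)
  finally show ?thesis
    by (rule ihom_ext[of "dual V B" "Unit V" _ A, rotated -1])
      (use f in \<open>auto simp: in_hom_iff dual_def[of V "dual V B"]\<close>)
qed

text \<open>This is the triangle identity of the adjunction of dualization with itself. Evaluation
  at \<open>E\<close> meets two bidual units, each contributing one swap, and the two swaps
  cancel.\<close>

lemma dual_bidual_unit:
  assumes [simp]: "E \<in> Ob V"
  shows "dual_map V (bidual_unit V E) \<cdot> bidual_unit V (dual V E) = Id V (dual V E)"
proof -
  have "ev V E (Unit V) \<cdot> (Id V E \<odot> (dual_map V (bidual_unit V E) \<cdot> bidual_unit V (dual V E)))
      = ev V (dual V (dual V E)) (Unit V) \<cdot> (bidual_unit V E \<odot> (bidual_unit V (dual V E) \<cdot> Id V (dual V E)))"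
    by (subst ev_dual_map) simp_all
  also have "\<dots> = ev V (dual V E) (Unit V) \<cdot> ((Id V (dual V E) \<odot> (bidual_unit V E \<cdot> Id V E)) \<cdot> symm V E (dual V E))"
    by (subst ev_bidual_unit) simp_all
  also have "\<dots> = (ev V (dual V E) (Unit V) \<cdot> (Id V (dual V E) \<odot> (bidual_unit V E \<cdot> Id V E))) \<cdot> symm V E (dual V E)"
    by (subst Comp_assoc_arr) (simp_all add: dual_def)
  also have "\<dots> = ev V E (Unit V) \<cdot> (Id V E \<odot> Id V (dual V E))"
    by (subst ev_bidual_unit) (simp_all add: dual_def)
  finally show ?thesis
    by (rule ihom_ext[of E "Unit V" _ "dual V E", rotated -1])
      (auto simp: in_hom_iff dual_def[of V E])
qed

text \<open>Transposing twice, against \<open>A\<close> and then against \<open>dual V B\<close>,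
  turns the square into an equation of arrows from
  \<open>dual V B \<otimes> (A \<otimes> ihom V A B)\<close> to the unit object. Both sides apply
  the internal arrow to the argument and the functional to the result; they differ only by a
  permutation of the factors.\<close>

lemma bidual_unit_enriched_natural:
  assumes [simp]: "A \<in> Ob V" "B \<in> Ob V"
  shows "hmap V (bidual_unit V A) (Id V (dual V (dual V B))) \<cdot>
      (ihom_contra V (Unit V) (dual V B) (dual V A) \<cdot> ihom_contra V (Unit V) A B)
    = hmap V (Id V A) (bidual_unit V B)" (is "?l = ?r")
proof -
  let ?R = "Unit V" and ?S = "ihom V A B" and ?P = "dual V B" and ?Q = "dual V A"
  let ?S' = "ihom V ?P ?Q" and ?c = "ihom_contra V (Unit V) A B"
  have [simp]: "Cod V ?c = ?S'" "Cod V (ihom_contra V ?R ?P ?Q) = ihom V (dual V ?Q) (dual V ?P)"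
    by (simp_all add: dual_def)
  have l: "ev V A (dual V ?P) \<cdot> (Id V A \<odot> ?l) = icomp V ?P ?Q ?R \<cdot> (bidual_unit V A \<odot> ?c)"
  proof -
    have "ev V A (dual V ?P) \<cdot> (Id V A \<odot> ?l)
        = ev V (dual V ?Q) (dual V ?P) \<cdot> (bidual_unit V A \<odot> (ihom_contra V ?R ?P ?Q \<cdot> ?c))"
      by (subst ev_hmap) simp_all
    also have "\<dots> = icomp V ?P ?Q ?R \<cdot> (bidual_unit V A \<odot> ?c)"
      using ev_ihom_contra[of ?P ?Q ?R "bidual_unit V A" ?c] by (simp flip: dual_def)
    finally show ?thesis .
  qed
  have r: "ev V A (dual V ?P) \<cdot> (Id V A \<odot> ?r) = bidual_unit V B \<cdot> ev V A B"
    by (subst ev_hmap') simp_all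
  have [simp]: "ihom V A ?R = ?Q" "ihom V B ?R = ?P" "ihom V ?Q ?R = dual V ?Q" "ihom V ?P ?R = dual V ?P"
    by (simp_all add: dual_def)
  \<comment> \<open>Second transposition, against \<open>dual V B\<close>. From here on
    \<open>?c\<close> and \<open>bidual_unit V A\<close> are pushed outwards until each meets the
    evaluation that computes it.\<close>
  have "ev V ?P ?R \<cdot> (Id V ?P \<odot> (icomp V ?P ?Q ?R \<cdot> (bidual_unit V A \<odot> ?c)))
      = ev V ?Q ?R \<cdot> ((ev V ?P ?Q \<odot> Id V (dual V ?Q)) \<cdot> (assc_inv ?P ?S' (dual V ?Q) \<cdot>
          (Id V ?P \<odot> (symm V (dual V ?Q) ?S' \<cdot> (bidual_unit V A \<odot> ?c)))))"
    by (subst ev_icomp) simp_all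
  also have "symm V (dual V ?Q) ?S' \<cdot> (bidual_unit V A \<odot> ?c) = (?c \<odot> bidual_unit V A) \<cdot> symm V A ?S"
    by (subst symm_natural_arr) simp_all
  also have "Id V ?P \<odot> \<dots> = (Id V ?P \<odot> (?c \<odot> bidual_unit V A)) \<cdot> (Id V ?P \<odot> symm V A ?S)"
    by simp
  also have "assc_inv ?P ?S' (dual V ?Q) \<cdot> \<dots>
      = (((Id V ?P \<odot> ?c) \<odot> bidual_unit V A) \<cdot> assc_inv ?P ?S A) \<cdot> (Id V ?P \<odot> symm V A ?S)"
    using assc_inv_natural[of "Id V ?P" ?c "bidual_unit V A" ?P ?S' "dual V ?Q"]
    by (intro Comp_eq_extend) simp_all
  also have "ev V ?Q ?R \<cdot> ((ev V ?P ?Q \<odot> Id V (dual V ?Q)) \<cdot> \<dots>)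
      = (ev V ?Q ?R \<cdot> ((ev V ?P ?Q \<cdot> (Id V ?P \<odot> ?c)) \<odot> (bidual_unit V A \<cdot> Id V A))) \<cdot> (assc_inv ?P ?S A \<cdot> (Id V ?P \<odot> symm V A ?S))"
    by simp
  \<comment> \<open>By definition \<open>?c\<close> is the transpose of
    \<open>icomp V A B ?R\<close>, so evaluating it recovers this composition.\<close>
  also have "ev V ?P ?Q \<cdot> (Id V ?P \<odot> ?c) = icomp V A B ?R"
    using ev_ihom_contra[of A B ?R "Id V ?P" "Id V ?S"] by simp
  also have "ev V ?Q ?R \<cdot> (icomp V A B ?R \<odot> (bidual_unit V A \<cdot> Id V A))
      = ev V A ?R \<cdot> ((Id V A \<odot> (icomp V A B ?R \<cdot> Id V (?P \<otimes> ?S))) \<cdot> symm V (?P \<otimes> ?S) A)"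
    by (subst ev_bidual_unit) simp_all
  also have "\<dots> = (ev V A ?R \<cdot> (Id V A \<odot> (icomp V A B ?R \<cdot> Id V (?P \<otimes> ?S)))) \<cdot> symm V (?P \<otimes> ?S) A"
    by (subst Comp_assoc_arr) simp_all
  also have "ev V A ?R \<cdot> (Id V A \<odot> (icomp V A B ?R \<cdot> Id V (?P \<otimes> ?S)))
      = ev V B ?R \<cdot> ((ev V A B \<odot> Id V ?P) \<cdot> (assc_inv A ?S ?P \<cdot> (Id V A \<odot> symm V ?P ?S)))"
    by (subst ev_icomp) simp_all
  also have "(\<dots> \<cdot> symm V (?P \<otimes> ?S) A) \<cdot> (assc_inv ?P ?S A \<cdot> (Id V ?P \<odot> symm V A ?S))
     = ev V B ?R \<cdot> ((ev V A B \<odot> Id V ?P) \<cdot> (assc_inv A ?S ?P \<cdot> ((Id V A \<odot> symm V ?P ?S) \<cdot> (symm V (?P \<otimes> ?S) A \<cdot>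
      (assc_inv ?P ?S A \<cdot> (Id V ?P \<odot> symm V A ?S))))))"
    by simp
  \<comment> \<open>One symmetry of this string comes from each of the two compositions and the
    middle one from the bidual unit; \<open>symm_tens\<close> merges all three.\<close>
  also have "\<dots> = ev V B ?R \<cdot> ((ev V A B \<odot> Id V ?P) \<cdot> symm V ?P (A \<otimes> ?S))"
    by (subst symm_tens) simp_all
  also have "\<dots> = ev V ?P ?R \<cdot> (Id V ?P \<odot> (bidual_unit V B \<cdot> ev V A B))"
    by (subst ev_bidual_unit) simp_all
  finally have "icomp V ?P ?Q ?R \<cdot> (bidual_unit V A \<odot> ?c) = bidual_unit V B \<cdot> ev V A B"
    by (rule ihom_ext[of ?P ?R _ "A \<otimes> ?S", rotated -1]) (auto simp: in_hom_iff)
  then have "ev V A (dual V ?P) \<cdot> (Id V A \<odot> ?l) = ev V A (dual V ?P) \<cdot> (Id V A \<odot> ?r)"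
    unfolding l r .
  then show ?thesis
    by (rule ihom_ext[of A "dual V ?P" _ ?S, rotated -1]) (auto simp: in_hom_iff)
qed

section \<open>Functional completeness\<close>

lemma curry_ev:
  assumes "A \<in> Ob V" "B \<in> Ob V" "g \<in> hom V D (ihom V A B)"
  shows "curry V A D B (ev V A B \<cdot> (Id V A \<odot> g)) = g"
proof -
  have "D \<in> Ob V"
    using assms(3) Dom_Ob[of g] by (simp add: in_hom_iff)
  with assms show ?thesis
    by (intro ihom_ext[OF assms(1,2) _ assms(3)] ev_curry_Id) (auto simp: in_hom_iff)
qed

lemma hmap_curry:
  assumes "h \<in> hom V E\<^sub>1 E\<^sub>2" "K \<in> Ob V" "D \<in> Ob V" "w \<in> hom V (E\<^sub>2 \<otimes> D) K"
  shows "hmap V h (Id V K) \<cdot> curry V E\<^sub>2 D K w = curry V E\<^sub>1 D K (w \<cdot> (h \<odot> Id V D))"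
proof -
  have [simp]: "E\<^sub>1 \<in> Ob V" "E\<^sub>2 \<in> Ob V"
    using assms(1) Dom_Ob[of h] Cod_Ob[of h] by (auto simp: in_hom_iff)
  have "ev V E\<^sub>1 K \<cdot> (Id V E\<^sub>1 \<odot> (hmap V h (Id V K) \<cdot> curry V E\<^sub>2 D K w))
      = ev V E\<^sub>2 K \<cdot> (h \<odot> (curry V E\<^sub>2 D K w \<cdot> Id V D))"
    using assms by (subst ev_hmap) (simp_all add: in_hom_iff)
  also have "\<dots> = w \<cdot> (h \<odot> Id V D)"
    using assms by (subst ev_curry) (simp_all add: in_hom_iff)
  also have "\<dots> = ev V E\<^sub>1 K \<cdot> (Id V E\<^sub>1 \<odot> curry V E\<^sub>1 D K (w \<cdot> (h \<odot> Id V D)))"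
    using assms by (subst ev_curry_Id) (simp_all add: in_hom_iff)
  finally show ?thesis
    by (rule ihom_ext[of E\<^sub>1 K _ D, rotated -1]) (use assms in \<open>auto simp: in_hom_iff\<close>)
qed

text \<open>Yoneda tests invertibility on arrows out of an arbitrary \<open>D\<close>, and currying
  moves the test to arrows out of \<open>E\<^sub>2 \<otimes> D\<close>. The parameter
  \<open>D\<close> expresses the enrichment, and the lemmas that follow work by choosing it.\<close>

lemma is_iso_hmap_iff:
  assumes h: "h \<in> hom V E\<^sub>1 E\<^sub>2" and K: "K \<in> Ob V"
  shows "is_iso V (hmap V h (Id V K)) \<longleftrightarrow>
    (\<forall>D \<in> Ob V. \<forall>u \<in> hom V (E\<^sub>1 \<otimes> D) K. \<exists>!w. w \<in> hom V (E\<^sub>2 \<otimes> D) K \<and> w \<cdot> (h \<odot> Id V D) = u)"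
proof -
  have [simp]: "E\<^sub>1 \<in> Ob V" "E\<^sub>2 \<in> Ob V" "K \<in> Ob V"
    using assms Dom_Ob[of h] Cod_Ob[of h] by (auto simp: in_hom_iff)
  have c_hom: "curry V E D K w \<in> hom V D (ihom V E K)"
    if "E \<in> Ob V" "D \<in> Ob V" "w \<in> hom V (E \<otimes> D) K" for E D w
    using that by (auto simp: in_hom_iff)
  have e_hom: "ev V E K \<cdot> (Id V E \<odot> g) \<in> hom V (E \<otimes> D) K"
    if "E \<in> Ob V" "D \<in> Ob V" "g \<in> hom V D (ihom V E K)" for E D g
    using that by (auto simp: in_hom_iff)
  have ec: "ev V E K \<cdot> (Id V E \<odot> curry V E D K w) = w"
    if "E \<in> Ob V" "D \<in> Ob V" "w \<in> hom V (E \<otimes> D) K" for E D w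
    using that by (intro ev_curry_Id) (auto simp: in_hom_iff)
  have r_hom: "w \<cdot> (h \<odot> Id V D) \<in> hom V (E\<^sub>1 \<otimes> D) K"
    if "D \<in> Ob V" "w \<in> hom V (E\<^sub>2 \<otimes> D) K" for D w
    using that h by (auto simp: in_hom_iff)
  have *: "(\<exists>!g. g \<in> hom V D (ihom V E\<^sub>2 K) \<and> hmap V h (Id V K) \<cdot> g = curry V E\<^sub>1 D K u)
      \<longleftrightarrow> (\<exists>!w. w \<in> hom V (E\<^sub>2 \<otimes> D) K \<and> w \<cdot> (h \<odot> Id V D) = u)" (is "?a \<longleftrightarrow> ?b")
    if D: "D \<in> Ob V" and u: "u \<in> hom V (E\<^sub>1 \<otimes> D) K" for D u
  proof -
    let ?c = "curry V E\<^sub>2 D K"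
    \<comment> \<open>Currying matches the extensions \<open>w\<close> of \<open>u\<close> with the
      solutions \<open>g\<close>, and evaluation is the inverse matching.\<close>
    have "bij_betw ?c {w. w \<in> hom V (E\<^sub>2 \<otimes> D) K \<and> w \<cdot> (h \<odot> Id V D) = u}
        {g. g \<in> hom V D (ihom V E\<^sub>2 K) \<and> hmap V h (Id V K) \<cdot> g = curry V E\<^sub>1 D K u}"
    proof (rule bij_betw_byWitness[where f' = "\<lambda>g. ev V E\<^sub>2 K \<cdot> (Id V E\<^sub>2 \<odot> g)"], goal_cases)
      case 1
      then show ?case using ec[OF _ D] by auto
    next
      case 2
      then show ?case using curry_ev[of E\<^sub>2 K _ D] by auto
    next
      case 3
      then show ?case using hmap_curry[OF h K D] c_hom D by auto
    next
      case 4
      show ?case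
      proof (rule image_subsetI, rule CollectI, elim CollectE conjE)
        fix g assume g: "g \<in> hom V D (ihom V E\<^sub>2 K)" and eq: "hmap V h (Id V K) \<cdot> g = curry V E\<^sub>1 D K u"
        let ?w = "ev V E\<^sub>2 K \<cdot> (Id V E\<^sub>2 \<odot> g)"
        have w: "?w \<in> hom V (E\<^sub>2 \<otimes> D) K"
          using e_hom[OF _ D g] by simp
        have "curry V E\<^sub>1 D K (?w \<cdot> (h \<odot> Id V D)) = curry V E\<^sub>1 D K u"
          using hmap_curry[OF h K D w] curry_ev[OF _ K g] eq by simp
        then have "ev V E\<^sub>1 K \<cdot> (Id V E\<^sub>1 \<odot> curry V E\<^sub>1 D K (?w \<cdot> (h \<odot> Id V D)))
            = ev V E\<^sub>1 K \<cdot> (Id V E\<^sub>1 \<odot> curry V E\<^sub>1 D K u)"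
          by (simp only:)
        then have "?w \<cdot> (h \<odot> Id V D) = u"
          unfolding ec[OF \<open>E\<^sub>1 \<in> Ob V\<close> D r_hom[OF D w]] ec[OF \<open>E\<^sub>1 \<in> Ob V\<close> D u] .
        with w show "?w \<in> hom V (E\<^sub>2 \<otimes> D) K \<and> ?w \<cdot> (h \<odot> Id V D) = u" ..
      qed
    qed
    then show ?thesis
      by (rule bij_betw_ex1_iff[symmetric])
  qed
  have "hmap V h (Id V K) \<in> hom V (ihom V E\<^sub>2 K) (ihom V E\<^sub>1 K)"
    using h by (auto simp: in_hom_iff)
  note is_iso_iff_postcomp_bij[OF this]
  moreover have "(\<forall>v \<in> hom V D (ihom V E\<^sub>1 K). \<exists>!g. g \<in> hom V D (ihom V E\<^sub>2 K) \<and> hmap V h (Id V K) \<cdot> g = v)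
      \<longleftrightarrow> (\<forall>u \<in> hom V (E\<^sub>1 \<otimes> D) K. \<exists>!w. w \<in> hom V (E\<^sub>2 \<otimes> D) K \<and> w \<cdot> (h \<odot> Id V D) = u)" (is "?l \<longleftrightarrow> ?r")
    if D: "D \<in> Ob V" for D
  proof
    assume ?l
    then show ?r
      using *[OF D] c_hom[OF \<open>E\<^sub>1 \<in> Ob V\<close> D] by simp
  next
    assume r: ?r
    show ?l
    proof
      fix v assume v: "v \<in> hom V D (ihom V E\<^sub>1 K)"
      \<comment> \<open>Every \<open>v\<close> is the transpose of its evaluation, so the case of a
        curried \<open>u\<close> covers all \<open>v\<close>.\<close>
      note e = e_hom[OF \<open>E\<^sub>1 \<in> Ob V\<close> D v]
      show "\<exists>!g. g \<in> hom V D (ihom V E\<^sub>2 K) \<and> hmap V h (Id V K) \<cdot> g = v"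
        using iffD2[OF *[OF D e]] r e curry_ev[OF \<open>E\<^sub>1 \<in> Ob V\<close> K v] by simp
    qed
  qed
  ultimately show ?thesis
    by simp
qed

text \<open>Arrows \<open>E \<otimes> D \<rightarrow> ihom V Z K\<close> correspond to arrows
  \<open>E \<otimes> (D \<otimes> Z) \<rightarrow> K\<close>, naturally in \<open>E\<close>. The
  test for \<open>ihom V Z K\<close> with parameter \<open>D\<close> is therefore the test for
  \<open>K\<close> with parameter \<open>D \<otimes> Z\<close>.\<close>

lemma is_iso_hmap_ihom:
  assumes h: "h \<in> hom V E\<^sub>1 E\<^sub>2" and K [simp]: "K \<in> Ob V" and Z [simp]: "Z \<in> Ob V"
    and iso: "is_iso V (hmap V h (Id V K))"
  shows "is_iso V (hmap V h (Id V (ihom V Z K)))"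
  unfolding is_iso_hmap_iff[OF h ihom_Ob[OF Z K]]
proof (intro ballI ex_ex1I)
  have E [simp]: "E\<^sub>1 \<in> Ob V" "E\<^sub>2 \<in> Ob V"
    using assms Dom_Ob[of h] Cod_Ob[of h] by (auto simp: in_hom_iff)
  have [simp]: "h \<in> Ar V" "Dom V h = E\<^sub>1" "Cod V h = E\<^sub>2"
    using h by (auto simp: in_hom_iff)
  fix D u assume D [simp]: "D \<in> Ob V" and u: "u \<in> hom V (E\<^sub>1 \<otimes> D) (ihom V Z K)"
  note iso' = iso[unfolded is_iso_hmap_iff[OF h K], rule_format, OF tens_Ob[OF D Z]]
  \<comment> \<open>\<open>?swap E\<close> rearranges \<open>E \<otimes> (D \<otimes> Z)\<close>
    into \<open>Z \<otimes> (E \<otimes> D)\<close>, the order in which evaluation at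
    \<open>Z\<close> expects its factors.\<close>
  let ?swap = "\<lambda>E. symm V (E \<otimes> D) Z \<cdot> assc_inv E D Z"
  let ?swap_inv = "\<lambda>E. assc V E D Z \<cdot> symm V Z (E \<otimes> D)"
  have nat: "?swap E\<^sub>2 \<cdot> (h \<odot> Id V (D \<otimes> Z)) = (Id V Z \<odot> (h \<odot> Id V D)) \<cdot> ?swap E\<^sub>1"
    using Comp_eq_extend[OF symm_natural_arr[of "h \<odot> Id V D" "Id V Z"], of "E\<^sub>2 \<otimes> D" Z "assc_inv E\<^sub>1 D Z"]
      assc_inv_natural[of h "Id V D" "Id V Z" E\<^sub>2 D Z] by simp
  have nat': "?swap_inv E\<^sub>2 \<cdot> (Id V Z \<odot> (h \<odot> Id V D)) = (h \<odot> Id V (D \<otimes> Z)) \<cdot> ?swap_inv E\<^sub>1"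
    using Comp_eq_extend[OF assc_natural[of h E\<^sub>1 E\<^sub>2 "Id V D" D D "Id V Z" Z Z, OF h], of "symm V Z (E\<^sub>1 \<otimes> D)"]
      symm_natural_arr[of "Id V Z" "h \<odot> Id V D" Z "E\<^sub>2 \<otimes> D"] by (simp add: in_hom_iff)
  have transpose: "(ev V Z K \<cdot> ((Id V Z \<odot> w) \<cdot> ?swap E\<^sub>2)) \<cdot> (h \<odot> Id V (D \<otimes> Z))
      = ev V Z K \<cdot> ((Id V Z \<odot> (w \<cdot> (h \<odot> Id V D))) \<cdot> ?swap E\<^sub>1)"
    if "w \<in> hom V (E\<^sub>2 \<otimes> D) (ihom V Z K)" for w
  proof -
    have "(ev V Z K \<cdot> ((Id V Z \<odot> w) \<cdot> ?swap E\<^sub>2)) \<cdot> (h \<odot> Id V (D \<otimes> Z))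
        = ev V Z K \<cdot> ((Id V Z \<odot> w) \<cdot> (?swap E\<^sub>2 \<cdot> (h \<odot> Id V (D \<otimes> Z))))"
      using that by (simp add: in_hom_iff)
    then show ?thesis
      unfolding nat using that by (simp add: in_hom_iff)
  qed
  {
    let ?u = "ev V Z K \<cdot> ((Id V Z \<odot> u) \<cdot> ?swap E\<^sub>1)"
    have "?u \<in> hom V (E\<^sub>1 \<otimes> (D \<otimes> Z)) K"
      using u by (auto simp: in_hom_iff)
    from iso'[OF this] obtain w where w: "w \<in> hom V (E\<^sub>2 \<otimes> (D \<otimes> Z)) K" "w \<cdot> (h \<odot> Id V (D \<otimes> Z)) = ?u"
      by blast
    let ?w = "curry V Z (E\<^sub>2 \<otimes> D) K (w \<cdot> ?swap_inv E\<^sub>2)"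
    have "ev V Z K \<cdot> (Id V Z \<odot> (?w \<cdot> (h \<odot> Id V D))) = (w \<cdot> ?swap_inv E\<^sub>2) \<cdot> (Id V Z \<odot> (h \<odot> Id V D))"
      using w by (subst ev_curry) (simp_all add: in_hom_iff)
    also have "\<dots> = w \<cdot> (?swap_inv E\<^sub>2 \<cdot> (Id V Z \<odot> (h \<odot> Id V D)))"
      using w by (subst Comp_assoc_arr) (simp_all add: in_hom_iff)
    also have "\<dots> = (w \<cdot> (h \<odot> Id V (D \<otimes> Z))) \<cdot> ?swap_inv E\<^sub>1"
      unfolding nat' using w(1) by (subst Comp_assoc_arr) (simp_all add: in_hom_iff)
    also have "\<dots> = ev V Z K \<cdot> (Id V Z \<odot> u)"
      unfolding w(2) using u by (simp add: in_hom_iff)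
    finally have "?w \<cdot> (h \<odot> Id V D) = u"
      by (rule ihom_ext[of Z K _ "E\<^sub>1 \<otimes> D", rotated -1]) (use w(1) u in \<open>auto simp: in_hom_iff\<close>)
    moreover have "?w \<in> hom V (E\<^sub>2 \<otimes> D) (ihom V Z K)"
      using w(1) by (auto simp: in_hom_iff)
    ultimately show "\<exists>w. w \<in> hom V (E\<^sub>2 \<otimes> D) (ihom V Z K) \<and> w \<cdot> (h \<odot> Id V D) = u"
      by blast
  next
    fix w w' assume w: "w \<in> hom V (E\<^sub>2 \<otimes> D) (ihom V Z K) \<and> w \<cdot> (h \<odot> Id V D) = u"
      and w': "w' \<in> hom V (E\<^sub>2 \<otimes> D) (ihom V Z K) \<and> w' \<cdot> (h \<odot> Id V D) = u"
    let ?t = "\<lambda>w. ev V Z K \<cdot> ((Id V Z \<odot> w) \<cdot> ?swap E\<^sub>2)"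
    have t: "?t w \<in> hom V (E\<^sub>2 \<otimes> (D \<otimes> Z)) K" "?t w' \<in> hom V (E\<^sub>2 \<otimes> (D \<otimes> Z)) K"
      using w w' by (auto simp: in_hom_iff)
    have "?t w \<cdot> (h \<odot> Id V (D \<otimes> Z)) \<in> hom V (E\<^sub>1 \<otimes> (D \<otimes> Z)) K"
      using t(1) by (auto simp: in_hom_iff)
    moreover have "?t w \<cdot> (h \<odot> Id V (D \<otimes> Z)) = ?t w' \<cdot> (h \<odot> Id V (D \<otimes> Z))"
      using transpose[of w] transpose[of w'] w w' by simp
    ultimately have "?t w = ?t w'"
      using iso' t by metis
    then have "?t w \<cdot> ?swap_inv E\<^sub>2 = ?t w' \<cdot> ?swap_inv E\<^sub>2"
      by (simp only:)
    then have "ev V Z K \<cdot> (Id V Z \<odot> w) = ev V Z K \<cdot> (Id V Z \<odot> w')"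
      using w w' by (simp add: in_hom_iff)
    then show "w = w'"
      by (rule ihom_ext[OF Z K, rotated -1]) (use w w' in auto)
  }
qed

text \<open>The parameter \<open>Unit V\<close> in \<open>is_iso_hmap_iff\<close> yields the
  ordinary extension property; the right unitors of \<open>E\<^sub>1\<close> and
  \<open>E\<^sub>2\<close> remove the extra tensor factor.\<close>

lemma unique_extension:
  assumes h: "h \<in> hom V E\<^sub>1 E\<^sub>2" and K: "K \<in> Ob V" and iso: "is_iso V (hmap V h (Id V K))"
    and f: "f \<in> hom V E\<^sub>1 K"
  shows "\<exists>!g. g \<in> hom V E\<^sub>2 K \<and> g \<cdot> h = f"
proof -
  have [simp]: "E\<^sub>1 \<in> Ob V" "E\<^sub>2 \<in> Ob V"
    using assms Dom_Ob[of h] Cod_Ob[of h] by (auto simp: in_hom_iff)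
  have r1: "runit V E\<^sub>1 \<in> Ar V" "Dom V (runit V E\<^sub>1) = E\<^sub>1 \<otimes> Unit V" "Cod V (runit V E\<^sub>1) = E\<^sub>1"
    using runit_hom[of E\<^sub>1] by (auto simp: in_hom_iff)
  have r2: "runit V E\<^sub>2 \<in> Ar V" "Dom V (runit V E\<^sub>2) = E\<^sub>2 \<otimes> Unit V" "Cod V (runit V E\<^sub>2) = E\<^sub>2"
    using runit_hom[of E\<^sub>2] by (auto simp: in_hom_iff)
  have nat: "runit V E\<^sub>2 \<cdot> (h \<odot> Id V (Unit V)) = h \<cdot> runit V E\<^sub>1"
    using runit_natural[OF h] .
  have ext: "(g \<cdot> runit V E\<^sub>2) \<cdot> (h \<odot> Id V (Unit V)) = f \<cdot> runit V E\<^sub>1 \<longleftrightarrow> g \<cdot> h = f"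
    if g: "g \<in> hom V E\<^sub>2 K" for g
  proof -
    have "(g \<cdot> runit V E\<^sub>2) \<cdot> (h \<odot> Id V (Unit V)) = g \<cdot> (runit V E\<^sub>2 \<cdot> (h \<odot> Id V (Unit V)))"
      using g h r2 by (subst Comp_assoc_arr) (simp_all add: in_hom_iff)
    also have "\<dots> = (g \<cdot> h) \<cdot> runit V E\<^sub>1"
      unfolding nat using g h r1 by (subst Comp_assoc_arr) (simp_all add: in_hom_iff)
    finally show ?thesis
      using iso_right_cancel[OF runit_iso runit_hom, of E\<^sub>1 "g \<cdot> h" K f] Comp_hom[OF h g] f by auto
  qed
  have "f \<cdot> runit V E\<^sub>1 \<in> hom V (E\<^sub>1 \<otimes> Unit V) K"
    using f r1 by (auto simp: in_hom_iff)
  from iso[unfolded is_iso_hmap_iff[OF h K], rule_format, OF Unit_Ob this]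
  have ex1: "\<exists>!w. w \<in> hom V (E\<^sub>2 \<otimes> Unit V) K \<and> w \<cdot> (h \<odot> Id V (Unit V)) = f \<cdot> runit V E\<^sub>1"
    .
  show ?thesis
  proof (rule ex_ex1I)
    from ex1 obtain w where w: "w \<in> hom V (E\<^sub>2 \<otimes> Unit V) K"
      "w \<cdot> (h \<odot> Id V (Unit V)) = f \<cdot> runit V E\<^sub>1" by blast
    let ?r' = "inverse_of V (runit V E\<^sub>2)"
    note r' = inverse_of_arr[OF runit_iso[OF \<open>E\<^sub>2 \<in> Ob V\<close>]]
    have g: "w \<cdot> ?r' \<in> hom V E\<^sub>2 K"
      using w(1) r' r2 by (auto simp: in_hom_iff)
    moreover have "(w \<cdot> ?r') \<cdot> runit V E\<^sub>2 = w"
      using w(1) r' r2 by (simp add: in_hom_iff)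
    ultimately show "\<exists>g. g \<in> hom V E\<^sub>2 K \<and> g \<cdot> h = f"
      using ext w(2) by metis
  next
    fix g g' assume g: "g \<in> hom V E\<^sub>2 K \<and> g \<cdot> h = f" "g' \<in> hom V E\<^sub>2 K \<and> g' \<cdot> h = f"
    moreover have "g \<cdot> runit V E\<^sub>2 \<in> hom V (E\<^sub>2 \<otimes> Unit V) K" "g' \<cdot> runit V E\<^sub>2 \<in> hom V (E\<^sub>2 \<otimes> Unit V) K"
      using g r2 by (auto simp: in_hom_iff)
    ultimately have "g \<cdot> runit V E\<^sub>2 = g' \<cdot> runit V E\<^sub>2"
      using ext ex1 by blast
    then show "g = g'"
      using iso_right_cancel[OF runit_iso runit_hom, of E\<^sub>2 g K g'] g by auto
  qed
qed

section \<open>Functional completeness of duals\<close>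

lemma is_iso_dual_map:
  assumes f: "f \<in> hom V A B" and iso: "is_iso V f"
  shows "is_iso V (dual_map V f)"
proof -
  obtain g where g: "g \<in> hom V B A" "g \<cdot> f = Id V A" "f \<cdot> g = Id V B"
    using iso f by (rule is_isoE)
  have [simp]: "A \<in> Ob V" "B \<in> Ob V"
    using f Dom_Ob[of f] Cod_Ob[of f] by (auto simp: in_hom_iff)
  show ?thesis
    by (rule is_isoI[of _ "dual V B" "dual V A" "dual_map V g"])
      (use f g in \<open>auto simp: in_hom_iff simp flip: dual_map_Comp\<close>)
qed

text \<open>The dual of \<open>h\<close> is a retract of its triple dual, via the triangle identity for the bidual.\<close>

lemma is_iso_dual_map_if_bidual:
  assumes h: "h \<in> hom V A B" and iso: "is_iso V (dual_map V (dual_map V h))"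
  shows "is_iso V (dual_map V h)"
proof -
  have [simp]: "A \<in> Ob V" "B \<in> Ob V" and h' [simp]: "h \<in> Ar V" "Dom V h = A" "Cod V h = B"
    using h Dom_Ob[of h] Cod_Ob[of h] by (auto simp: in_hom_iff)
  let ?h3 = "dual_map V (dual_map V (dual_map V h))"
  have "is_iso V ?h3"
    using is_iso_dual_map[OF _ iso] by (simp add: in_hom_iff)
  then obtain k where k: "k \<in> hom V (dual V (dual V (dual V A))) (dual V (dual V (dual V B)))"
      "k \<cdot> ?h3 = Id V (dual V (dual V (dual V B)))" "?h3 \<cdot> k = Id V (dual V (dual V (dual V A)))"
    by (rule is_isoE) auto
  have k' [simp]: "k \<in> Ar V" "Dom V k = dual V (dual V (dual V A))" "Cod V k = dual V (dual V (dual V B))"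
    using k(1) by (auto simp: in_hom_iff)
  have n1: "?h3 \<cdot> bidual_unit V (dual V B) = bidual_unit V (dual V A) \<cdot> dual_map V h"
    by (rule bidual_unit_natural) simp_all
  have n2: "dual_map V (bidual_unit V A) \<cdot> ?h3 = dual_map V h \<cdot> dual_map V (bidual_unit V B)"
    using bidual_unit_natural[OF h'] by (simp flip: dual_map_Comp)
  \<comment> \<open>The inverse \<open>k\<close> is carried along the retract: a bidual unit enters
    the triple dual of \<open>A\<close>, and the dual of a bidual unit leaves that of
    \<open>B\<close>. Naturality as in \<open>n1\<close> gives the left inverse law, as in
    \<open>n2\<close> the right one.\<close>
  let ?g = "dual_map V (bidual_unit V B) \<cdot> (k \<cdot> bidual_unit V (dual V A))"
  have "?g \<cdot> dual_map V h = dual_map V (bidual_unit V B) \<cdot> (k \<cdot> (?h3 \<cdot> bidual_unit V (dual V B)))"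
    unfolding n1 by simp
  also have "\<dots> = Id V (dual V B)"
    using Comp_eq_extend[OF k(2)] by (simp add: dual_bidual_unit)
  finally have 1: "?g \<cdot> dual_map V h = Id V (dual V B)" .
  have "dual_map V h \<cdot> ?g = (dual_map V h \<cdot> dual_map V (bidual_unit V B)) \<cdot> (k \<cdot> bidual_unit V (dual V A))"
    by simp
  also have "\<dots> = Id V (dual V A)"
    unfolding n2[symmetric] using Comp_eq_extend[OF k(3)] by (simp add: dual_bidual_unit)
  finally have 2: "dual_map V h \<cdot> ?g = Id V (dual V A)" .
  show ?thesis
    by (rule is_isoI[OF _ _ 1 2]) auto
qed

text \<open>The dual of \<open>Z\<close> is an internal hom into the unit object, so
  \<open>is_iso_hmap_ihom\<close> lifts the invertibility of \<open>dual_map V h\<close> to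
  it.\<close>

lemma functionally_complete_dual:
  assumes "Z \<in> Ob V"
  shows "functionally_complete V (dual V Z)"
  unfolding functionally_complete_def
proof (intro conjI ballI impI)
  fix h assume h: "h \<in> Ar V" and "is_iso V (dual_map V (dual_map V h))"
  then have "is_iso V (dual_map V h)"
    using is_iso_dual_map_if_bidual[of h "Dom V h" "Cod V h"] by auto
  then show "is_iso V (hmap V h (Id V (dual V Z)))"
    unfolding dual_map_def dual_def[of V Z] using h assms by (intro is_iso_hmap_ihom) auto
qed (use assms in simp)

section \<open>Reflections into the functionally complete objects\<close>

lemma fc_reflection_Id:
  assumes "functionally_complete V K"
  shows "fc_reflection V K K (Id V K)"
  using assms by (auto simp: fc_reflection_def functionally_complete_def is_iso_Id)

lemma fc_reflection_bidual:
  assumes E [simp]: "E \<in> Ob V" and refl: "reflexive V (dual V E)"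
  shows "fc_reflection V E (dual V (dual V E)) (bidual_unit V E)"
  unfolding fc_reflection_def
proof (intro conjI allI impI)
  obtain g where g: "g \<in> hom V (dual V (dual V (dual V E))) (dual V E)"
    "g \<cdot> bidual_unit V (dual V E) = Id V (dual V E)"
    "bidual_unit V (dual V E) \<cdot> g = Id V (dual V (dual V (dual V E)))"
    using refl unfolding reflexive_def by (rule is_isoE) auto
  \<comment> \<open>Both \<open>g\<close> and the dual of \<open>bidual_unit V E\<close> are left
    inverses of the same isomorphism, hence they are equal.\<close>
  have "dual_map V (bidual_unit V E) \<cdot> bidual_unit V (dual V E) = g \<cdot> bidual_unit V (dual V E)"
    using g(2) by (simp add: dual_bidual_unit)
  then have g_eq: "dual_map V (bidual_unit V E) = g"
    by (rule iso_right_cancel[OF refl[unfolded reflexive_def], rotated -1])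
      (use g(1) in \<open>auto simp: in_hom_iff\<close>)
  have "is_iso V (dual_map V (bidual_unit V E))"
    unfolding g_eq using g by (intro is_isoI) auto
  then have "is_iso V (dual_map V (dual_map V (bidual_unit V E)))"
    by (rule is_iso_dual_map[rotated]) auto
  then show "is_iso V (hmap V (bidual_unit V E) (Id V E'))" if "functionally_complete V E'" for E'
    using that by (auto simp: functionally_complete_def)
qed (auto simp: functionally_complete_dual)

text \<open>\<open>completion\<close> is a Hilbert choice, so it has its defining property at
  \<open>E\<close> as soon as one reflection of \<open>E\<close> is known.\<close>

lemma fc_reflection_completion:
  assumes "fc_reflection V E K d"
  shows "fc_reflection V E (completion_ob V E) (completion_unit V E)"
  unfolding completion_ob_def completion_unit_def completion_def
  by (rule someI[of "\<lambda>r. fc_reflection V E (fst r) (snd r)" "(K, d)"]) (simp add: assms)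

lemma fc_reflection_extension:
  assumes "fc_reflection V E K d" "functionally_complete V K'" "f \<in> hom V E K'"
  shows "\<exists>!g. g \<in> hom V K K' \<and> g \<cdot> d = f"
  using assms unfolding fc_reflection_def functionally_complete_def
  by (intro unique_extension) auto

section \<open>The completion monad\<close>

lemma fc_reflectionD:
  assumes "fc_reflection V E K d"
  shows "d \<in> Ar V" "Dom V d = E" "Cod V d = K" "E \<in> Ob V" "K \<in> Ob V" "functionally_complete V K"
  using assms Dom_Ob[of d] Cod_Ob[of d] by (auto simp: fc_reflection_def in_hom_iff)

text \<open>A reflection acts as an epimorphism towards functionally complete objects. The
  multiplication laws of the comparison are checked on units by means of this.\<close>

lemma fc_reflection_cancel:
  assumes "fc_reflection V E K d" "functionally_complete V K'"
    and "g \<in> hom V K K'" "g' \<in> hom V K K'" "g \<cdot> d = g' \<cdot> d"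
  shows "g = g'"
proof -
  have "g \<cdot> d \<in> hom V E K'"
    using fc_reflectionD[OF assms(1)] assms(3) by (auto simp: in_hom_iff)
  from fc_reflection_extension[OF assms(1,2) this] assms(3-5) show ?thesis
    by metis
qed

lemma fc_reflections_iso:
  assumes r: "fc_reflection V E K d" and r': "fc_reflection V E K' d'"
    and g: "g \<in> hom V K K'" "g \<cdot> d = d'"
  shows "is_iso V g"
proof -
  note d = fc_reflectionD[OF r] and d' = fc_reflectionD[OF r']
  have "d \<in> hom V E K" "d' \<in> hom V E K'"
    using d d' by auto
  then obtain k where k: "k \<in> hom V K' K" "k \<cdot> d' = d"
    using fc_reflection_extension[OF r' d(6)] by blast
  have "k \<cdot> g = Id V K"
    by (rule fc_reflection_cancel[OF r d(6)]) (use d g k in \<open>auto simp: in_hom_iff\<close>)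
  moreover have "g \<cdot> k = Id V K'"
    by (rule fc_reflection_cancel[OF r' d'(6)]) (use d' d g k in \<open>auto simp: in_hom_iff\<close>)
  ultimately show ?thesis
    using g(1) k(1) by (intro is_isoI) auto
qed

text \<open>\<open>completion_ob\<close> and \<open>completion_unit\<close> are total functions;
  this marks the objects at which the choice is a genuine reflection.\<close>

abbreviation has_completion :: "'o \<Rightarrow> bool" where
  "has_completion E \<equiv> fc_reflection V E (completion_ob V E) (completion_unit V E)"

text \<open>A functionally complete object is reflected by its identity. The multiplication of the
  completion monad needs this, since it starts at a twice completed object.\<close>

lemma has_completion_completion_ob:
  "has_completion E \<Longrightarrow> has_completion (completion_ob V E)"
  by (rule fc_reflection_completion[OF fc_reflection_Id]) (rule fc_reflectionD)

text \<open>The bidual of any object is functionally complete, so \<open>bidual_unit V E\<close>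
  extends uniquely along the completion unit and the definite description denotes.\<close>

lemma completion_embedding:
  assumes "has_completion E"
  shows "completion_embedding V E \<in> hom V (completion_ob V E) (dual V (dual V E))"
    "completion_embedding V E \<cdot> completion_unit V E = bidual_unit V E"
proof -
  have "E \<in> Ob V"
    by (rule fc_reflectionD[OF assms])
  then have "functionally_complete V (dual V (dual V E))" "bidual_unit V E \<in> hom V E (dual V (dual V E))"
    by (auto intro: functionally_complete_dual)
  from theI'[OF fc_reflection_extension[OF assms this]]
  show "completion_embedding V E \<in> hom V (completion_ob V E) (dual V (dual V E))"
    "completion_embedding V E \<cdot> completion_unit V E = bidual_unit V E"
    unfolding completion_embedding_def by auto
qed

lemma completion_monad_Mar:
  assumes "has_completion E" "has_completion E'" "h \<in> hom V E E'"
  shows "Mar (completion_monad V) h \<in> hom V (completion_ob V E) (completion_ob V E')"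
    "Mar (completion_monad V) h \<cdot> completion_unit V E = completion_unit V E' \<cdot> h"
proof -
  note r = fc_reflectionD[OF assms(2)]
  have "completion_unit V E' \<cdot> h \<in> hom V E (completion_ob V E')"
    using r assms(3) by (auto simp: in_hom_iff)
  moreover have "Dom V h = E" "Cod V h = E'"
    using assms(3) by (auto simp: in_hom_iff)
  ultimately show "Mar (completion_monad V) h \<in> hom V (completion_ob V E) (completion_ob V E')"
    "Mar (completion_monad V) h \<cdot> completion_unit V E = completion_unit V E' \<cdot> h"
    using theI'[OF fc_reflection_extension[OF assms(1) r(6)]]
    by (simp_all add: completion_monad_def)
qed

lemma completion_monad_Mmult:
  assumes "has_completion E"
  shows "Mmult (completion_monad V) E \<in> hom V (completion_ob V (completion_ob V E)) (completion_ob V E)"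
    "Mmult (completion_monad V) E \<cdot> completion_unit V (completion_ob V E) = Id V (completion_ob V E)"
proof -
  note r = fc_reflectionD[OF assms]
  have "Id V (completion_ob V E) \<in> hom V (completion_ob V E) (completion_ob V E)"
    using r by auto
  from theI'[OF fc_reflection_extension[OF has_completion_completion_ob[OF assms] r(6) this]]
  show "Mmult (completion_monad V) E \<in> hom V (completion_ob V (completion_ob V E)) (completion_ob V E)"
    "Mmult (completion_monad V) E \<cdot> completion_unit V (completion_ob V E) = Id V (completion_ob V E)"
    unfolding completion_monad_def by auto
qed

text \<open>The second equation is enriched naturality of the completion unit. It replaces the
  explicit inverse in the definition and has the same form as
  \<open>bidual_monad_Mhom\<close>.\<close>

lemma completion_monad_Mhom:
  assumes "has_completion A" "has_completion B"
  shows "Mhom (completion_monad V) A B \<in> hom V (ihom V A B) (ihom V (completion_ob V A) (completion_ob V B))"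
    "hmap V (completion_unit V A) (Id V (completion_ob V B)) \<cdot> Mhom (completion_monad V) A B
      = hmap V (Id V A) (completion_unit V B)"
proof -
  note a = fc_reflectionD[OF assms(1)] and b = fc_reflectionD[OF assms(2)]
  have "is_iso V (hmap V (completion_unit V A) (Id V (completion_ob V B)))"
    using assms(1) b(6) by (simp add: fc_reflection_def)
  note i = inverse_of_arr[OF this]
  show "Mhom (completion_monad V) A B \<in> hom V (ihom V A B) (ihom V (completion_ob V A) (completion_ob V B))"
    using i a b by (auto simp: completion_monad_def)
  show "hmap V (completion_unit V A) (Id V (completion_ob V B)) \<cdot> Mhom (completion_monad V) A B
      = hmap V (Id V A) (completion_unit V B)"
    using Comp_eq_extend[OF i(5)] i a b by (simp add: completion_monad_def)
qed

section \<open>Comparison of the completion monad with the bidual monad\<close>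

lemma bidual_monad_Mhom:
  assumes "A \<in> Ob V" "B \<in> Ob V"
  shows "Mhom (bidual_monad V) A B \<in> hom V (ihom V A B) (ihom V (dual V (dual V A)) (dual V (dual V B)))"
    "hmap V (bidual_unit V A) (Id V (dual V (dual V B))) \<cdot> Mhom (bidual_monad V) A B
      = hmap V (Id V A) (bidual_unit V B)"
  using bidual_unit_enriched_natural[OF assms] assms
  by (auto simp: bidual_monad_def dual_def)

text \<open>Precomposition with the completion unit of \<open>A\<close> turns both sides into
  \<open>hmap V (Id V A) (bidual_unit V B)\<close>. It is invertible on internal homs into the
  bidual of \<open>B\<close>, so it can be cancelled.\<close>

lemma completion_embedding_enriched_natural:
  assumes A: "has_completion A" and B: "has_completion B"
  shows "hmap V (Id V (completion_ob V A)) (completion_embedding V B) \<cdot> Mhom (completion_monad V) A B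
    = hmap V (completion_embedding V A) (Id V (dual V (dual V B))) \<cdot> Mhom (bidual_monad V) A B"
    (is "?l \<cdot> ?S = ?r \<cdot> ?T")
proof -
  note a = fc_reflectionD[OF A] and b = fc_reflectionD[OF B]
  have i: "completion_embedding V E \<in> Ar V" "Dom V (completion_embedding V E) = completion_ob V E"
    "Cod V (completion_embedding V E) = dual V (dual V E)" if "has_completion E" for E
    using completion_embedding[OF that] by (simp_all add: in_hom_iff)
  note [simp] = i[OF A] i[OF B] a(1-5) b(1-5)
  note S = completion_monad_Mhom[OF A B] and T = bidual_monad_Mhom[OF a(4) b(4)]
  have [simp]: "?S \<in> Ar V" "Dom V ?S = ihom V A B" "Cod V ?S = ihom V (completion_ob V A) (completion_ob V B)"
    using S(1) by (simp_all add: in_hom_iff)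
  have [simp]: "?T \<in> Ar V" "Dom V ?T = ihom V A B" "Cod V ?T = ihom V (dual V (dual V A)) (dual V (dual V B))"
    using T(1) by (simp_all add: in_hom_iff)
  let ?d = "hmap V (completion_unit V A) (Id V (dual V (dual V B)))"
  have "?d \<cdot> (?l \<cdot> ?S) = (?d \<cdot> ?l) \<cdot> ?S"
    by (subst Comp_assoc_arr) simp_all
  also have "?d \<cdot> ?l = hmap V (Id V A) (completion_embedding V B) \<cdot> hmap V (completion_unit V A) (Id V (completion_ob V B))"
    by (simp add: hmap_Comp)
  also have "\<dots> \<cdot> ?S = hmap V (Id V A) (completion_embedding V B) \<cdot> hmap V (Id V A) (completion_unit V B)"
    unfolding S(2)[symmetric] by (subst Comp_assoc_arr) simp_all
  also have "\<dots> = hmap V (Id V A) (bidual_unit V B)"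
    by (simp add: hmap_Comp completion_embedding(2)[OF B])
  also have "\<dots> = hmap V (bidual_unit V A) (Id V (dual V (dual V B))) \<cdot> ?T"
    by (rule T(2)[symmetric])
  also have "hmap V (bidual_unit V A) (Id V (dual V (dual V B))) = ?d \<cdot> ?r"
    by (simp add: hmap_Comp completion_embedding(2)[OF A])
  also have "(?d \<cdot> ?r) \<cdot> ?T = ?d \<cdot> (?r \<cdot> ?T)"
    by (subst Comp_assoc_arr) simp_all
  finally have eq: "?d \<cdot> (?l \<cdot> ?S) = ?d \<cdot> (?r \<cdot> ?T)" .
  have "is_iso V ?d"
    using A functionally_complete_dual[of "dual V B"] by (simp add: fc_reflection_def)
  then show ?thesis
    by (rule iso_left_cancel[OF _ _ _ _ eq]) (auto simp: in_hom_iff)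
qed

text \<open>The unit law of Kleisli extension: naturality of the unit reduces it to the triangle
  identity at \<open>dual V E\<close>. The counterpart is \<open>completion_monad_Mmult_Mar\<close>;
  together they evaluate multiplications on units.\<close>

lemma bidual_monad_Mmult:
  assumes E: "E \<in> Ob V" and g: "g \<in> hom V Z (dual V (dual V E))"
  shows "(Mmult (bidual_monad V) E \<cdot> Mar (bidual_monad V) g) \<cdot> bidual_unit V Z = g"
proof -
  have [simp]: "Z \<in> Ob V" and g' [simp]: "g \<in> Ar V" "Dom V g = Z" "Cod V g = dual V (dual V E)"
    using g Dom_Ob[of g] by (auto simp: in_hom_iff)
  show ?thesis
    using Comp_eq_extend[OF dual_bidual_unit[of "dual V E"], of g] E
    by (simp add: bidual_monad_def bidual_unit_natural[OF g'])
qed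

lemma completion_monad_Mmult_Mar:
  assumes E: "has_completion E" and Z: "has_completion Z" and g: "g \<in> hom V Z (completion_ob V E)"
  shows "(Mmult (completion_monad V) E \<cdot> Mar (completion_monad V) g) \<cdot> completion_unit V Z = g"
proof -
  note H = has_completion_completion_ob[OF E]
  note simps = fc_reflectionD[OF E] fc_reflectionD[OF Z] fc_reflectionD[OF H]
  note M = completion_monad_Mar[OF Z H g] and m = completion_monad_Mmult[OF E]
  show ?thesis
    using M m g simps Comp_eq_extend[OF m(2), of g] by (simp add: in_hom_iff)
qed

text \<open>Later \<open>e\<close> and \<open>e'\<close> are counits at the bidual and at the
  completion, \<open>t\<close> is the image under \<open>F G\<close> of the embedding, and
  \<open>eq\<close> is naturality of the counit. On the completion unit of \<open>Z\<close>, both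
  sides reduce to \<open>e \<cdot> t\<close>.\<close>

lemma completion_embedding_mult:
  assumes E: "has_completion E" and Z: "has_completion Z"
    and e: "e \<in> hom V W (dual V (dual V E))" and e': "e' \<in> hom V Z (completion_ob V E)"
    and t: "t \<in> hom V Z W" and eq: "e \<cdot> t = completion_embedding V E \<cdot> e'"
  shows "completion_embedding V E \<cdot> (Mmult (completion_monad V) E \<cdot> Mar (completion_monad V) e')
    = (Mmult (bidual_monad V) E \<cdot> Mar (bidual_monad V) e) \<cdot> (Mar (bidual_monad V) t \<cdot> completion_embedding V Z)"
    (is "?i \<cdot> ?m = ?n \<cdot> (?t \<cdot> ?j)")
proof -
  note H = has_completion_completion_ob[OF E]
  note [simp] = fc_reflectionD(1-5)[OF E] fc_reflectionD(1-5)[OF Z] fc_reflectionD(1-5)[OF H]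
  note m = completion_monad_Mar[OF Z H e'] completion_monad_Mmult[OF E]
  note i = completion_embedding[OF E] completion_embedding[OF Z]
  have W [simp]: "W \<in> Ob V"
    using t Cod_Ob[of t] by (auto simp: in_hom_iff)
  have t' [simp]: "t \<in> Ar V" "Dom V t = Z" "Cod V t = W"
    using t by (simp_all add: in_hom_iff)
  have m': "?m \<in> hom V (completion_ob V Z) (completion_ob V E)"
    using m by (auto simp: in_hom_iff)
  have n': "?n \<in> hom V (dual V (dual V W)) (dual V (dual V E))"
    using e by (auto simp: bidual_monad_def in_hom_iff)
  have t'': "?t \<in> hom V (dual V (dual V Z)) (dual V (dual V W))"
    by (auto simp: bidual_monad_def)
  have "(?i \<cdot> ?m) \<cdot> completion_unit V Z = ?i \<cdot> (?m \<cdot> completion_unit V Z)"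
    using i m' by (intro Comp_assoc_arr) (auto simp: in_hom_iff)
  also have "\<dots> = e \<cdot> t"
    unfolding completion_monad_Mmult_Mar[OF E Z e'] eq ..
  also have "\<dots> = (?n \<cdot> bidual_unit V W) \<cdot> t"
    using bidual_monad_Mmult[OF _ e] by simp
  also have "\<dots> = ?n \<cdot> (?t \<cdot> bidual_unit V Z)"
    using n' bidual_unit_natural[OF t'] by (subst Comp_assoc_arr) (simp_all add: in_hom_iff bidual_monad_def)
  also have "\<dots> = (?n \<cdot> (?t \<cdot> ?j)) \<cdot> completion_unit V Z"
    unfolding i(4)[symmetric]
    by (subst (1 2) Comp_assoc_arr) (use n' t'' i(3) in \<open>simp_all add: in_hom_iff\<close>)
  finally show ?thesis
    by (rule fc_reflection_cancel[OF Z functionally_complete_dual[of "dual V E"], rotated -1])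
      (use i m' n' t'' in \<open>auto simp: in_hom_iff\<close>)
qed

text \<open>Here \<open>k\<close> and \<open>l\<close> stand for the inverse embeddings at
  \<open>E\<close> and \<open>W\<close>. The equation concerns arrows out of the bidual of
  \<open>W\<close>, so the test uses \<open>bidual_unit V W\<close>, which \<open>refl\<close> makes
  a reflection.\<close>

lemma completion_embedding_inverse_mult:
  assumes E: "has_completion E" and Z: "has_completion Z" and W: "has_completion W"
    and refl: "fc_reflection V W (dual V (dual V W)) (bidual_unit V W)"
    and k: "k \<in> hom V (dual V (dual V E)) (completion_ob V E)"
    and l: "l \<in> hom V (dual V (dual V W)) (completion_ob V W)" "l \<cdot> bidual_unit V W = completion_unit V W"
    and e: "e \<in> hom V W (dual V (dual V E))" and e': "e' \<in> hom V Z (completion_ob V E)"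
    and t: "t \<in> hom V W Z" and eq: "e' \<cdot> t = k \<cdot> e"
  shows "k \<cdot> (Mmult (bidual_monad V) E \<cdot> Mar (bidual_monad V) e)
    = (Mmult (completion_monad V) E \<cdot> Mar (completion_monad V) e') \<cdot> (Mar (completion_monad V) t \<cdot> l)"
    (is "_ \<cdot> ?n = ?m \<cdot> (?t \<cdot> _)")
proof -
  note H = has_completion_completion_ob[OF E]
  note [simp] = fc_reflectionD(1-5)[OF E] fc_reflectionD(1-5)[OF Z] fc_reflectionD(1-5)[OF H]
    fc_reflectionD(1-5)[OF W]
  note m = completion_monad_Mar[OF Z H e'] completion_monad_Mmult[OF E]
  note t' = completion_monad_Mar[OF W Z t]
  have m': "?m \<in> hom V (completion_ob V Z) (completion_ob V E)"
    using m by (auto simp: in_hom_iff)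
  have n': "?n \<in> hom V (dual V (dual V W)) (dual V (dual V E))"
    using e by (auto simp: bidual_monad_def in_hom_iff)
  have "(k \<cdot> ?n) \<cdot> bidual_unit V W = k \<cdot> (?n \<cdot> bidual_unit V W)"
    using k n' by (intro Comp_assoc_arr) (auto simp: in_hom_iff)
  also have "\<dots> = e' \<cdot> t"
    using bidual_monad_Mmult[OF _ e] eq by simp
  also have "\<dots> = (?m \<cdot> completion_unit V Z) \<cdot> t"
    unfolding completion_monad_Mmult_Mar[OF E Z e'] ..
  also have "\<dots> = ?m \<cdot> (completion_unit V Z \<cdot> t)"
    using m' t by (intro Comp_assoc_arr) (simp_all add: in_hom_iff)
  also have "\<dots> = ?m \<cdot> (?t \<cdot> (l \<cdot> bidual_unit V W))"
    unfolding t'(2) l(2) ..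
  also have "\<dots> = (?m \<cdot> (?t \<cdot> l)) \<cdot> bidual_unit V W"
    by (subst (1 2) Comp_assoc_arr) (use m' t'(1) l(1) in \<open>simp_all add: in_hom_iff\<close>)
  finally show ?thesis
    by (rule fc_reflection_cancel[OF refl fc_reflectionD(6)[OF E], rotated -1])
      (use k l(1) m' n' t'(1) in \<open>auto simp: in_hom_iff\<close>)
qed

text \<open>Applying \<open>hmap V i' j'\<close> to the given square cancels \<open>j\<close> on one
  side and \<open>i\<close> on the other.\<close>

lemma enriched_natural_inverse:
  assumes i: "i \<in> hom V A A'" and i': "i' \<in> hom V A' A" "i \<cdot> i' = Id V A'"
    and j: "j \<in> hom V B B'" and j': "j' \<in> hom V B' B" "j' \<cdot> j = Id V B"
    and s: "s \<in> hom V W (ihom V A B)" and t: "t \<in> hom V W (ihom V A' B')"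
    and eq: "hmap V (Id V A) j \<cdot> s = hmap V i (Id V B') \<cdot> t"
  shows "hmap V (Id V A') j' \<cdot> t = hmap V i' (Id V B) \<cdot> s"
proof -
  have [simp]: "A \<in> Ob V" "A' \<in> Ob V" "B \<in> Ob V" "B' \<in> Ob V"
    using i j Dom_Ob[of i] Dom_Ob[of j] Cod_Ob[of i] Cod_Ob[of j] by (auto simp: in_hom_iff)
  note [simp] = i[unfolded in_hom_iff] i'[unfolded in_hom_iff] j[unfolded in_hom_iff]
    j'[unfolded in_hom_iff] s[unfolded in_hom_iff] t[unfolded in_hom_iff]
  have "hmap V i' (Id V B) \<cdot> s = (hmap V i' j' \<cdot> hmap V (Id V A) j) \<cdot> s"
    by (simp add: hmap_Comp del: Comp_assoc_arr)
  also have "\<dots> = hmap V i' j' \<cdot> (hmap V (Id V A) j \<cdot> s)"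
    by (rule Comp_assoc_arr) simp_all
  also have "\<dots> = (hmap V i' j' \<cdot> hmap V i (Id V B')) \<cdot> t"
    unfolding eq by (subst Comp_assoc_arr) simp_all
  also have "\<dots> = hmap V (Id V A') j' \<cdot> t"
    by (simp add: hmap_Comp del: Comp_assoc_arr)
  finally show ?thesis ..
qed

end

section \<open>Symmetric monoidal adjunctions\<close>

context cat_functor
begin

lemma far_arr [simp]:
  assumes "f \<in> Ar C"
  shows "far T f \<in> Ar D" "Dom D (far T f) = fob T (Dom C f)" "Cod D (far T f) = fob T (Cod C f)"
  using far_hom[of f "Dom C f" "Cod C f"] assms by (auto simp: dom.in_hom_iff cod.in_hom_iff)

lemma far_Comp_arr:
  "f \<in> Ar C \<Longrightarrow> g \<in> Ar C \<Longrightarrow> Dom C g = Cod C f \<Longrightarrow> far T (g \<cdot>\<^bsub>C\<^esub> f) = far T g \<cdot>\<^bsub>D\<^esub> far T f"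
  using far_Comp[of f "Dom C f" "Cod C f" g "Cod C g"] by (simp add: dom.in_hom_iff)

declare fob_Ob [simp] far_Id [simp]

lemma far_eq_Comp:
  assumes "g \<cdot>\<^bsub>C\<^esub> f = g' \<cdot>\<^bsub>C\<^esub> f'" "f \<in> Ar C" "g \<in> Ar C" "Dom C g = Cod C f"
    "f' \<in> Ar C" "g' \<in> Ar C" "Dom C g' = Cod C f'"
  shows "far T g \<cdot>\<^bsub>D\<^esub> far T f = far T g' \<cdot>\<^bsub>D\<^esub> far T f'"
  using assms far_Comp_arr by metis

end

context symmetric_monoidal_adjunction
begin

section \<open>Hom-objects of induced monads\<close>

lemma mult_arr [simp]:
  shows "A \<in> Ob X \<Longrightarrow> B \<in> Ob X \<Longrightarrow> mult F A B \<in> Ar L"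
    "A \<in> Ob X \<Longrightarrow> B \<in> Ob X \<Longrightarrow> Dom L (mult F A B) = fob F A \<otimes>\<^bsub>L\<^esub> fob F B"
    "A \<in> Ob X \<Longrightarrow> B \<in> Ob X \<Longrightarrow> Cod L (mult F A B) = fob F (A \<otimes>\<^bsub>X\<^esub> B)"
    "E \<in> Ob L \<Longrightarrow> E' \<in> Ob L \<Longrightarrow> mult G E E' \<in> Ar X"
    "E \<in> Ob L \<Longrightarrow> E' \<in> Ob L \<Longrightarrow> Dom X (mult G E E') = fob G E \<otimes>\<^bsub>X\<^esub> fob G E'"
    "E \<in> Ob L \<Longrightarrow> E' \<in> Ob L \<Longrightarrow> Cod X (mult G E E') = fob G (E \<otimes>\<^bsub>L\<^esub> E')"
  using F.mult_hom[of A B] G.mult_hom[of E E'] by (simp_all add: F.dom.in_hom_iff F.cod.in_hom_iff)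

lemma eta_arr [simp]:
  assumes "A \<in> Ob X"
  shows "\<eta> A \<in> Ar X" "Dom X (\<eta> A) = A" "Cod X (\<eta> A) = fob G (fob F A)"
  using eta_hom[OF assms] by (simp_all add: F.dom.in_hom_iff)

lemma right_adjoint_hom_arr [simp]:
  assumes "E \<in> Ob L" "E' \<in> Ob L"
  shows "right_adjoint_hom X L G E E' \<in> Ar X"
    "Dom X (right_adjoint_hom X L G E E') = fob G (ihom L E E')"
    "Cod X (right_adjoint_hom X L G E E') = ihom X (fob G E) (fob G E')"
  using assms by (simp_all add: right_adjoint_hom_def)

lemma left_adjoint_hom_arr [simp]:
  assumes "A \<in> Ob X" "B \<in> Ob X"
  shows "left_adjoint_hom X L F G \<eta> A B \<in> Ar X"
    "Dom X (left_adjoint_hom X L F G \<eta> A B) = ihom X A B"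
    "Cod X (left_adjoint_hom X L F G \<eta> A B) = fob G (ihom L (fob F A) (fob F B))"
  using assms by (simp_all add: left_adjoint_hom_def)

text \<open>After evaluation both sides are the image under \<open>G\<close> of
  \<open>f \<cdot> ev \<cdot> (g \<odot> Id)\<close>, preceded by \<open>mult G\<close>. Naturality
  of \<open>mult G\<close> is used in its first argument for \<open>g\<close> and in its second for
  \<open>hmap L g f\<close>.\<close>

lemma right_adjoint_hom_natural:
  assumes g: "g \<in> hom L E\<^sub>1 E" and f: "f \<in> hom L E' E\<^sub>1'"
  shows "hmap X (far G g) (far G f) \<cdot>\<^bsub>X\<^esub> right_adjoint_hom X L G E E'
    = right_adjoint_hom X L G E\<^sub>1 E\<^sub>1' \<cdot>\<^bsub>X\<^esub> far G (hmap L g f)"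
proof -
  have [simp]: "g \<in> Ar L" "Dom L g = E\<^sub>1" "Cod L g = E" "f \<in> Ar L" "Dom L f = E'" "Cod L f = E\<^sub>1'"
    using f g by (simp_all add: F.cod.in_hom_iff)
  have [simp]: "E \<in> Ob L" "E\<^sub>1 \<in> Ob L" "E' \<in> Ob L" "E\<^sub>1' \<in> Ob L"
    using F.cod.Dom_Ob[of g] F.cod.Cod_Ob[of g] F.cod.Dom_Ob[of f] F.cod.Cod_Ob[of f] by auto
  let ?A = "ihom L E E'" and ?A' = "ihom L E\<^sub>1 E\<^sub>1'" and ?h = "hmap L g f"
  have nat1: "mult G E\<^sub>1 ?A' \<cdot>\<^bsub>X\<^esub> (Id X (fob G E\<^sub>1) \<odot>\<^bsub>X\<^esub> far G ?h)
      = far G (Id L E\<^sub>1 \<odot>\<^bsub>L\<^esub> ?h) \<cdot>\<^bsub>X\<^esub> mult G E\<^sub>1 ?A"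
    using G.mult_natural[of "Id L E\<^sub>1" E\<^sub>1 E\<^sub>1 ?h ?A ?A'] by (simp add: F.cod.in_hom_iff)
  have nat2: "mult G E ?A \<cdot>\<^bsub>X\<^esub> (far G g \<odot>\<^bsub>X\<^esub> Id X (fob G ?A))
      = far G (g \<odot>\<^bsub>L\<^esub> Id L ?A) \<cdot>\<^bsub>X\<^esub> mult G E\<^sub>1 ?A"
    using G.mult_natural[of g E\<^sub>1 E "Id L ?A" ?A ?A] by (simp add: F.cod.in_hom_iff)
  have ev: "ev L E\<^sub>1 E\<^sub>1' \<cdot>\<^bsub>L\<^esub> (Id L E\<^sub>1 \<odot>\<^bsub>L\<^esub> ?h) = f \<cdot>\<^bsub>L\<^esub> (ev L E E' \<cdot>\<^bsub>L\<^esub> (g \<odot>\<^bsub>L\<^esub> Id L ?A))"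
    by (subst F.cod.ev_hmap') simp_all
  have "ev X (fob G E\<^sub>1) (fob G E\<^sub>1') \<cdot>\<^bsub>X\<^esub> (Id X (fob G E\<^sub>1) \<odot>\<^bsub>X\<^esub>
        (hmap X (far G g) (far G f) \<cdot>\<^bsub>X\<^esub> right_adjoint_hom X L G E E'))
      = far G f \<cdot>\<^bsub>X\<^esub> (ev X (fob G E) (fob G E') \<cdot>\<^bsub>X\<^esub>
          (far G g \<odot>\<^bsub>X\<^esub> (right_adjoint_hom X L G E E' \<cdot>\<^bsub>X\<^esub> Id X (fob G ?A))))"
    by (subst F.dom.ev_hmap) simp_all
  also have "\<dots> = far G f \<cdot>\<^bsub>X\<^esub> ((far G (ev L E E') \<cdot>\<^bsub>X\<^esub> mult G E ?A) \<cdot>\<^bsub>X\<^esub> (far G g \<odot>\<^bsub>X\<^esub> Id X (fob G ?A)))"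
    unfolding right_adjoint_hom_def by (subst F.dom.ev_curry) simp_all
  also have "\<dots> = far G f \<cdot>\<^bsub>X\<^esub> (far G (ev L E E') \<cdot>\<^bsub>X\<^esub> (far G (g \<odot>\<^bsub>L\<^esub> Id L ?A) \<cdot>\<^bsub>X\<^esub> mult G E\<^sub>1 ?A))"
    using nat2 by simp
  also have "\<dots> = far G (f \<cdot>\<^bsub>L\<^esub> (ev L E E' \<cdot>\<^bsub>L\<^esub> (g \<odot>\<^bsub>L\<^esub> Id L ?A))) \<cdot>\<^bsub>X\<^esub> mult G E\<^sub>1 ?A"
    by (simp add: G.far_Comp_arr)
  also have "\<dots> = far G (ev L E\<^sub>1 E\<^sub>1') \<cdot>\<^bsub>X\<^esub> (far G (Id L E\<^sub>1 \<odot>\<^bsub>L\<^esub> ?h) \<cdot>\<^bsub>X\<^esub> mult G E\<^sub>1 ?A)"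
    unfolding ev[symmetric] by (subst G.far_Comp_arr) simp_all
  also have "\<dots> = (far G (ev L E\<^sub>1 E\<^sub>1') \<cdot>\<^bsub>X\<^esub> mult G E\<^sub>1 ?A') \<cdot>\<^bsub>X\<^esub> (Id X (fob G E\<^sub>1) \<odot>\<^bsub>X\<^esub> far G ?h)"
    unfolding nat1[symmetric] by (subst F.dom.Comp_assoc_arr) simp_all
  also have "\<dots> = ev X (fob G E\<^sub>1) (fob G E\<^sub>1') \<cdot>\<^bsub>X\<^esub> (Id X (fob G E\<^sub>1) \<odot>\<^bsub>X\<^esub>
      (right_adjoint_hom X L G E\<^sub>1 E\<^sub>1' \<cdot>\<^bsub>X\<^esub> far G ?h))"
    unfolding right_adjoint_hom_def by (subst F.dom.ev_curry) simp_all
  finally show ?thesis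
    by (rule F.dom.ihom_ext[of "fob G E\<^sub>1" "fob G E\<^sub>1'" _ "fob G ?A", rotated -1])
      (auto simp: F.dom.in_hom_iff)
qed

text \<open>The structure of the left adjoint is a common right factor of both sides. The arrows
  \<open>far G j\<close> and \<open>far G i\<close> pass the structure of the right adjoint by its
  naturality, and the square left between is the image of \<open>eq\<close> under \<open>G\<close>.
  With \<open>S\<close> and \<open>T\<close> arbitrary, this serves the comparison and its
  inverse.\<close>

lemma induced_monad_enriched_natural:
  fixes S T :: "('l, 'b, 'b) emonad"
  assumes A: "A \<in> Ob X" and B: "B \<in> Ob X"
    and i: "i \<in> hom L (Mob S (fob F A)) (Mob T (fob F A))"
    and j: "j \<in> hom L (Mob S (fob F B)) (Mob T (fob F B))"
    and S: "Mhom S (fob F A) (fob F B)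
      \<in> hom L (ihom L (fob F A) (fob F B)) (ihom L (Mob S (fob F A)) (Mob S (fob F B)))"
    and T: "Mhom T (fob F A) (fob F B)
      \<in> hom L (ihom L (fob F A) (fob F B)) (ihom L (Mob T (fob F A)) (Mob T (fob F B)))"
    and eq: "hmap L (Id L (Mob S (fob F A))) j \<cdot>\<^bsub>L\<^esub> Mhom S (fob F A) (fob F B)
      = hmap L i (Id L (Mob T (fob F B))) \<cdot>\<^bsub>L\<^esub> Mhom T (fob F A) (fob F B)"
  shows "hmap X (Id X (fob G (Mob S (fob F A)))) (far G j)
        \<cdot>\<^bsub>X\<^esub> Mhom (induced_monad X L F G \<eta> \<epsilon> (base_change G S)) A B
      = hmap X (far G i) (Id X (fob G (Mob T (fob F B))))
        \<cdot>\<^bsub>X\<^esub> Mhom (induced_monad X L F G \<eta> \<epsilon> (base_change G T)) A B"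
proof -
  let ?SA = "Mob S (fob F A)" and ?SB = "Mob S (fob F B)"
  let ?TA = "Mob T (fob F A)" and ?TB = "Mob T (fob F B)"
  let ?s = "Mhom S (fob F A) (fob F B)" and ?t = "Mhom T (fob F A) (fob F B)"
  have [simp]: "i \<in> Ar L" "Dom L i = ?SA" "Cod L i = ?TA" "j \<in> Ar L" "Dom L j = ?SB" "Cod L j = ?TB"
    using i j by (simp_all add: F.cod.in_hom_iff)
  have [simp]: "?SA \<in> Ob L" "?TA \<in> Ob L" "?SB \<in> Ob L" "?TB \<in> Ob L"
    using F.cod.Dom_Ob[of i] F.cod.Cod_Ob[of i] F.cod.Dom_Ob[of j] F.cod.Cod_Ob[of j] by auto
  have [simp]: "?s \<in> Ar L" "Dom L ?s = ihom L (fob F A) (fob F B)" "Cod L ?s = ihom L ?SA ?SB"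
    "?t \<in> Ar L" "Dom L ?t = ihom L (fob F A) (fob F B)" "Cod L ?t = ihom L ?TA ?TB"
    using S T by (simp_all add: F.cod.in_hom_iff)
  note [simp] = A B
  let ?l = "left_adjoint_hom X L F G \<eta> A B"
  have "hmap X (Id X (fob G ?SA)) (far G j) \<cdot>\<^bsub>X\<^esub> (right_adjoint_hom X L G ?SA ?SB \<cdot>\<^bsub>X\<^esub> (far G ?s \<cdot>\<^bsub>X\<^esub> ?l))
      = (hmap X (far G (Id L ?SA)) (far G j) \<cdot>\<^bsub>X\<^esub> right_adjoint_hom X L G ?SA ?SB) \<cdot>\<^bsub>X\<^esub> (far G ?s \<cdot>\<^bsub>X\<^esub> ?l)"
    by simp
  also have "\<dots> = right_adjoint_hom X L G ?SA ?TB \<cdot>\<^bsub>X\<^esub>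
      ((far G (hmap L (Id L ?SA) j) \<cdot>\<^bsub>X\<^esub> far G ?s) \<cdot>\<^bsub>X\<^esub> ?l)"
    by (subst right_adjoint_hom_natural[of _ ?SA _ _ _ ?TB]) (auto simp: F.cod.in_hom_iff)
  also have "far G (hmap L (Id L ?SA) j) \<cdot>\<^bsub>X\<^esub> far G ?s = far G (hmap L i (Id L ?TB)) \<cdot>\<^bsub>X\<^esub> far G ?t"
    by (rule G.far_eq_Comp[OF eq]) simp_all
  also have "right_adjoint_hom X L G ?SA ?TB \<cdot>\<^bsub>X\<^esub>
      ((far G (hmap L i (Id L ?TB)) \<cdot>\<^bsub>X\<^esub> far G ?t) \<cdot>\<^bsub>X\<^esub> ?l)
    = (right_adjoint_hom X L G ?SA ?TB \<cdot>\<^bsub>X\<^esub> far G (hmap L i (Id L ?TB))) \<cdot>\<^bsub>X\<^esub> (far G ?t \<cdot>\<^bsub>X\<^esub> ?l)"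
    by simp
  also have "\<dots> = (hmap X (far G i) (far G (Id L ?TB)) \<cdot>\<^bsub>X\<^esub> right_adjoint_hom X L G ?TA ?TB) \<cdot>\<^bsub>X\<^esub> (far G ?t \<cdot>\<^bsub>X\<^esub> ?l)"
    by (subst right_adjoint_hom_natural[of _ ?SA _ _ _ ?TB]) (auto simp: F.cod.in_hom_iff)
  also have "\<dots> = hmap X (far G i) (Id X (fob G ?TB)) \<cdot>\<^bsub>X\<^esub> (right_adjoint_hom X L G ?TA ?TB \<cdot>\<^bsub>X\<^esub> (far G ?t \<cdot>\<^bsub>X\<^esub> ?l))"
    by simp
  finally show ?thesis
    by (simp add: induced_monad_def base_change_def)
qed

text \<open>Reflexivity makes the bidual a reflection at every object \<open>F A\<close>. This also
  covers the multiplications: their counits start at objects \<open>F (G E)\<close>, again in the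
  image of \<open>F\<close>, and the one for the completion monad ends at a completed object, which
  reflects itself.\<close>

lemma distribution_comparison_isomorphism:
  assumes reflexive: "\<And>A. A \<in> Ob X \<Longrightarrow> reflexive L (dual L (fob F A))"
  shows "emonad_isomorphism X
      (accessible_distribution_monad X L F G \<eta> \<epsilon>)
      (natural_distribution_monad X L F G \<eta> \<epsilon>)
      (distribution_comparison L F G)" (is ?iso)
    and "A \<in> Ob X \<Longrightarrow> completion_embedding L (fob F A)
      \<in> hom L (completion_ob L (fob F A)) (dual L (dual L (fob F A)))"
    and "A \<in> Ob X \<Longrightarrow> is_iso L (completion_embedding L (fob F A))"
proof -
  let ?C = "completion_monad L" and ?B = "bidual_monad L"
  let ?H = "\<lambda>A. completion_ob L (fob F A)" and ?D = "\<lambda>A. dual L (dual L (fob F A))"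
  let ?i = "\<lambda>A. completion_embedding L (fob F A)"
  define k where "k A = inverse_of L (?i A)" for A
  have bidual: "fc_reflection L (fob F A) (?D A) (bidual_unit L (fob F A))" if "A \<in> Ob X" for A
    using that reflexive[OF that] by (intro F.cod.fc_reflection_bidual) simp_all
  have compl: "F.cod.has_completion (fob F A)" if "A \<in> Ob X" for A
    using bidual[OF that] by (rule F.cod.fc_reflection_completion)
  have i: "?i A \<in> hom L (?H A) (?D A)"
      "?i A \<cdot>\<^bsub>L\<^esub> completion_unit L (fob F A) = bidual_unit L (fob F A)" if "A \<in> Ob X" for A
    using F.cod.completion_embedding[OF compl[OF that]] .
  have iso: "is_iso L (?i A)" if "A \<in> Ob X" for A
    using F.cod.fc_reflections_iso[OF compl bidual i] that by blast
  show "?i A \<in> hom L (?H A) (?D A)" "is_iso L (?i A)" if "A \<in> Ob X"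
    using i(1) iso that by blast+
  have Ob [simp]: "?H A \<in> Ob L" "?D A \<in> Ob L" if "A \<in> Ob X" for A
    using F.cod.fc_reflectionD(5)[OF compl[OF that]] that by simp_all
  have i_arr [simp]: "?i A \<in> Ar L" "Dom L (?i A) = ?H A" "Cod L (?i A) = ?D A" if "A \<in> Ob X" for A
    using i(1)[OF that] by (simp_all add: F.cod.in_hom_iff)
  have k_arr [simp]: "k A \<in> Ar L" "Dom L (k A) = ?D A" "Cod L (k A) = ?H A"
      "k A \<cdot>\<^bsub>L\<^esub> ?i A = Id L (?H A)" "?i A \<cdot>\<^bsub>L\<^esub> k A = Id L (?D A)" if "A \<in> Ob X" for A
    unfolding k_def using F.cod.inverse_of_arr[OF iso[OF that]] that by simp_all
  \<comment> \<open>This equation gives the unit law of the inverse family and the hypothesis on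
    \<open>l\<close> in \<open>completion_embedding_inverse_mult\<close>.\<close>
  have k_unit: "k A \<cdot>\<^bsub>L\<^esub> bidual_unit L (fob F A) = completion_unit L (fob F A)" if "A \<in> Ob X" for A
  proof -
    note d = F.cod.fc_reflectionD[OF compl[OF that]]
    have "k A \<cdot>\<^bsub>L\<^esub> (?i A \<cdot>\<^bsub>L\<^esub> completion_unit L (fob F A)) = Id L (?H A) \<cdot>\<^bsub>L\<^esub> completion_unit L (fob F A)"
      using that d by (intro F.cod.Comp_eq_extend) simp_all
    with that d show ?thesis
      by (simp add: i(2))
  qed
  have eps [simp]: "\<epsilon> E \<in> Ar L" "Dom L (\<epsilon> E) = fob F (fob G E)" "Cod L (\<epsilon> E) = E" if "E \<in> Ob L" for E
    using eps_hom[OF that] by (simp_all add: F.cod.in_hom_iff)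
  let ?S = "accessible_distribution_monad X L F G \<eta> \<epsilon>" and ?T = "natural_distribution_monad X L F G \<eta> \<epsilon>"
  let ?j = "distribution_comparison L F G" and ?k = "\<lambda>A. far G (k A)"
  have Mob: "Mob ?S A = fob G (?H A)" "Mob ?T A = fob G (?D A)" for A
    by (simp_all add: accessible_distribution_monad_def natural_distribution_monad_def
        induced_monad_def base_change_def completion_monad_def bidual_monad_def)
  have Mar: "Mar ?S f = far G (Mar ?C (far F f))" "Mar ?T f = far G (Mar ?B (far F f))" for f
    by (simp_all add: accessible_distribution_monad_def natural_distribution_monad_def
        induced_monad_def base_change_def)
  have Munit: "Munit ?S A = far G (completion_unit L (fob F A)) \<cdot>\<^bsub>X\<^esub> \<eta> A"
      "Munit ?T A = far G (bidual_unit L (fob F A)) \<cdot>\<^bsub>X\<^esub> \<eta> A" for A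
    by (simp_all add: accessible_distribution_monad_def natural_distribution_monad_def
        induced_monad_def base_change_def completion_monad_def bidual_monad_def)
  have Mmult: "Mmult ?S A = far G (Mmult ?C (fob F A)) \<cdot>\<^bsub>X\<^esub> far G (Mar ?C (\<epsilon> (?H A)))"
      "Mmult ?T A = far G (Mmult ?B (fob F A)) \<cdot>\<^bsub>X\<^esub> far G (Mar ?B (\<epsilon> (?D A)))" for A
    by (simp_all add: accessible_distribution_monad_def natural_distribution_monad_def
        induced_monad_def base_change_def completion_monad_def bidual_monad_def)
  have Mob_L: "Mob ?C E = completion_ob L E" "Mob ?B E = dual L (dual L E)" for E
    by (simp_all add: completion_monad_def bidual_monad_def)
  have C_hom: "Mhom ?C (fob F A) (fob F B) \<in> hom L (ihom L (fob F A) (fob F B)) (ihom L (?H A) (?H B))"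
    if "A \<in> Ob X" "B \<in> Ob X" for A B
    using that by (intro F.cod.completion_monad_Mhom compl)
  have B_hom: "Mhom ?B (fob F A) (fob F B) \<in> hom L (ihom L (fob F A) (fob F B)) (ihom L (?D A) (?D B))"
    if "A \<in> Ob X" "B \<in> Ob X" for A B
    using that by (intro F.cod.bidual_monad_Mhom) simp_all
  have nat: "hmap L (Id L (?H A)) (?i B) \<cdot>\<^bsub>L\<^esub> Mhom ?C (fob F A) (fob F B)
      = hmap L (?i A) (Id L (?D B)) \<cdot>\<^bsub>L\<^esub> Mhom ?B (fob F A) (fob F B)"
    if "A \<in> Ob X" "B \<in> Ob X" for A B
    using that by (intro F.cod.completion_embedding_enriched_natural compl)
  have nat': "hmap L (Id L (?D A)) (k B) \<cdot>\<^bsub>L\<^esub> Mhom ?B (fob F A) (fob F B)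
      = hmap L (k A) (Id L (?H B)) \<cdot>\<^bsub>L\<^esub> Mhom ?C (fob F A) (fob F B)"
    if "A \<in> Ob X" "B \<in> Ob X" for A B
    by (rule F.cod.enriched_natural_inverse[OF _ _ _ _ _ _ C_hom[OF that] B_hom[OF that] nat[OF that]])
      (use that in \<open>auto simp: F.cod.in_hom_iff\<close>)
  \<comment> \<open>Instance with \<open>F (G (?H A))\<close> for \<open>Z\<close> and
    \<open>F (G (?D A))\<close> for \<open>W\<close>; the required square is naturality of the
    counit at \<open>?i A\<close>.\<close>
  have mult: "?i A \<cdot>\<^bsub>L\<^esub> (Mmult ?C (fob F A) \<cdot>\<^bsub>L\<^esub> Mar ?C (\<epsilon> (?H A)))
      = (Mmult ?B (fob F A) \<cdot>\<^bsub>L\<^esub> Mar ?B (\<epsilon> (?D A)))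
        \<cdot>\<^bsub>L\<^esub> (Mar ?B (far F (far G (?i A))) \<cdot>\<^bsub>L\<^esub> ?i (fob G (?H A)))" if A: "A \<in> Ob X" for A
    using A eps_natural[OF i(1)[OF A]]
    by (intro F.cod.completion_embedding_mult[OF compl compl]) (auto simp: F.cod.in_hom_iff)
  have mult': "k A \<cdot>\<^bsub>L\<^esub> (Mmult ?B (fob F A) \<cdot>\<^bsub>L\<^esub> Mar ?B (\<epsilon> (?D A)))
      = (Mmult ?C (fob F A) \<cdot>\<^bsub>L\<^esub> Mar ?C (\<epsilon> (?H A)))
        \<cdot>\<^bsub>L\<^esub> (Mar ?C (far F (far G (k A))) \<cdot>\<^bsub>L\<^esub> k (fob G (?D A)))" if A: "A \<in> Ob X" for A
    using A eps_natural[of "k A" "?D A" "?H A"]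
    by (intro F.cod.completion_embedding_inverse_mult[OF compl compl compl bidual])
      (auto simp: F.cod.in_hom_iff k_unit)
  have C_mult: "Mmult ?C (fob F A) \<in> hom L (completion_ob L (?H A)) (?H A)"
    "Mar ?C (\<epsilon> (?H A)) \<in> hom L (?H (fob G (?H A))) (completion_ob L (?H A))"
    "Mar ?C (far F (far G (k A))) \<in> hom L (?H (fob G (?D A))) (?H (fob G (?H A)))" if "A \<in> Ob X" for A
    using F.cod.completion_monad_Mmult(1)[OF compl[OF that]]
      F.cod.completion_monad_Mar(1)[OF compl F.cod.has_completion_completion_ob[OF compl[OF that]],
        of "fob G (?H A)" "\<epsilon> (?H A)"]
      F.cod.completion_monad_Mar(1)[OF compl compl,
        of "fob G (?D A)" "fob G (?H A)" "far F (far G (k A))"] that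
    by (auto simp: F.cod.in_hom_iff)
  have B_mult: "Mmult ?B (fob F A) \<in> hom L (dual L (dual L (?D A))) (?D A)"
    "Mar ?B (\<epsilon> (?D A)) \<in> hom L (?D (fob G (?D A))) (dual L (dual L (?D A)))"
    "Mar ?B (far F (far G (?i A))) \<in> hom L (?D (fob G (?H A))) (?D (fob G (?D A)))" if "A \<in> Ob X" for A
    using that by (auto simp: F.cod.in_hom_iff bidual_monad_def)
  have "emonad_morphism X ?S ?T ?j"
    unfolding emonad_morphism_def distribution_comparison_def Mob
  proof (intro conjI ballI)
    fix A B assume A: "A \<in> Ob X" and B: "B \<in> Ob X"
    show "far G (?i A) \<in> hom X (fob G (?H A)) (fob G (?D A))"
      using A by (auto simp: F.dom.in_hom_iff)
    show "hmap X (Id X (fob G (?H A))) (far G (?i B)) \<cdot>\<^bsub>X\<^esub> Mhom ?S A B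
        = hmap X (far G (?i A)) (Id X (fob G (?D B))) \<cdot>\<^bsub>X\<^esub> Mhom ?T A B"
      unfolding accessible_distribution_monad_def natural_distribution_monad_def
      by (rule induced_monad_enriched_natural[OF A B, where S = ?C and T = ?B, unfolded Mob_L])
        (use A B i C_hom B_hom nat in auto)
    show "far G (?i A) \<cdot>\<^bsub>X\<^esub> Munit ?S A = Munit ?T A"
      unfolding Munit using A F.cod.fc_reflectionD[OF compl[OF A]]
      by (intro F.dom.Comp_eq_extend) (simp_all add: i(2) flip: G.far_Comp_arr)
    show "far G (?i A) \<cdot>\<^bsub>X\<^esub> Mmult ?S A
        = Mmult ?T A \<cdot>\<^bsub>X\<^esub> (Mar ?T (far G (?i A)) \<cdot>\<^bsub>X\<^esub> far G (?i (fob G (?H A))))"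
      using arg_cong[OF mult[OF A], of "far G"] A C_mult[OF A] B_mult[OF A]
      by (simp add: Mmult Mar G.far_Comp_arr F.cod.in_hom_iff)
  qed
  \<comment> \<open>The inverse must satisfy its own squares: \<open>nat'\<close> follows formally
    from \<open>nat\<close>, whereas \<open>mult'\<close> was tested on bidual units.\<close>
  moreover have "emonad_morphism X ?T ?S ?k"
    unfolding emonad_morphism_def Mob
  proof (intro conjI ballI)
    fix A B assume A: "A \<in> Ob X" and B: "B \<in> Ob X"
    show "far G (k A) \<in> hom X (fob G (?D A)) (fob G (?H A))"
      using A by (auto simp: F.dom.in_hom_iff)
    show "hmap X (Id X (fob G (?D A))) (far G (k B)) \<cdot>\<^bsub>X\<^esub> Mhom ?T A B
        = hmap X (far G (k A)) (Id X (fob G (?H B))) \<cdot>\<^bsub>X\<^esub> Mhom ?S A B"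
      unfolding accessible_distribution_monad_def natural_distribution_monad_def
      by (rule induced_monad_enriched_natural[OF A B, where S = ?B and T = ?C, unfolded Mob_L])
        (use A B C_hom B_hom nat' in \<open>auto simp: F.cod.in_hom_iff\<close>)
    show "far G (k A) \<cdot>\<^bsub>X\<^esub> Munit ?T A = Munit ?S A"
      unfolding Munit using A
      by (intro F.dom.Comp_eq_extend) (simp_all add: k_unit flip: G.far_Comp_arr)
    show "far G (k A) \<cdot>\<^bsub>X\<^esub> Mmult ?T A
        = Mmult ?S A \<cdot>\<^bsub>X\<^esub> (Mar ?S (far G (k A)) \<cdot>\<^bsub>X\<^esub> far G (k (fob G (?D A))))"
      using arg_cong[OF mult'[OF A], of "far G"] A C_mult[OF A] B_mult[OF A]
      by (simp add: Mmult Mar G.far_Comp_arr F.cod.in_hom_iff)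
  qed
  moreover have "?k A \<cdot>\<^bsub>X\<^esub> ?j A = Id X (Mob ?S A) \<and> ?j A \<cdot>\<^bsub>X\<^esub> ?k A = Id X (Mob ?T A)" if "A \<in> Ob X" for A
    using that unfolding distribution_comparison_def Mob by (simp flip: G.far_Comp_arr)
  ultimately show ?iso
    unfolding emonad_isomorphism_def by (intro conjI exI[of _ ?k]) auto
qed

end

theorem theorem7p5p7:
  fixes X :: "('x, 'a) smcc" and L :: "('l, 'b) smcc"
    and F :: "('x, 'a, 'l, 'b) mfunc" and G :: "('l, 'b, 'x, 'a) mfunc"
    and \<eta> :: "'x \<Rightarrow> 'a" and \<epsilon> :: "'l \<Rightarrow> 'b"
  assumes adjunction: "symmetric_monoidal_adjunction X L F G \<eta> \<epsilon>"
    and well_complete: "finitely_well_complete L"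
    and cotensors_reflexive: "\<And>A. A \<in> Ob X \<Longrightarrow> reflexive L (cotensor L F A (Unit L))"
  shows "emonad_isomorphism X
           (accessible_distribution_monad X L F G \<eta> \<epsilon>)
           (natural_distribution_monad X L F G \<eta> \<epsilon>)
           (distribution_comparison L F G)
       \<and> (\<forall>A \<in> Ob X.
            completion_embedding L (fob F A)
              \<in> hom L (Mob (completion_monad L) (fob F A)) (Mob (bidual_monad L) (fob F A))
            \<and> is_iso L (completion_embedding L (fob F A)))"
proof -
  interpret symmetric_monoidal_adjunction X L F G \<eta> \<epsilon>
    by (rule adjunction)
  have "reflexive L (dual L (fob F A))" if "A \<in> Ob X" for A
    using cotensors_reflexive[OF that] by (simp add: cotensor_def dual_def)
  from distribution_comparison_isomorphism[OF this] show ?thesis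
    by (simp add: completion_monad_def bidual_monad_def)
qed

end
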